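(* Let $X$ be a proper ultra-metric space. Suppose there is an increasing unbounded sequence $\vec r=(r_n)_{n\in\mathbb N}$ of positive real numbers such that $$\prod_{n\in\mathbb N}\frac{\mathrm{Ent}_{r_n}^{r_{n+1}}(X)}{\mathrm{ent}_{r_n}^{r_{n+1}}(X)}<+\infty .$$ Then $X$ is coarsely equivalent to the anti-Cantor set $2^{<\omega}$.
   Context: A metric space $(X,d)$ is proper if $X$ is unbounded but every closed ball $B_r(x_0)=\{x\in X:d(x,x_0)\le r\}$ is compact; it is an ultra-metric space if $d(x,y)\le\max\{d(x,z),d(z,y)\}$ for all $x,y,z\in X$. For a subset $B$ of a metric space and real $\varepsilon>0$, $\mathrm{Ent}_\varepsilon(B)$ is the smallest cardinality $|N|$ of an $\varepsilon$-net $N\subset B$, i.e. a subset such that for each $x\in B$ there is $y\in N$ with $\mathrm{dist}(x,y)<\varepsilon$. For $\varepsilon>0$, $\delta\ge0$ put $$\mathrm{Ent}_\varepsilon^\delta(X)=\sup_{x\in X}\mathrm{Ent}_\varepsilon(B_\delta(x)),\qquad \mathrm{ent}_\varepsilon^\delta(X)=\min_{x\in X}\mathrm{Ent}_\varepsilon(B_\delta(x)).$$ For proper $X$ the number $\mathrm{ent}_\varepsilon^\delta(X)$ is finite; a quotient with infinite numerator is regarded as $+\infty$, so the hypothesis includes finiteness of all the numerators. The anti-Cantor set is $2^{<\omega}=\{(x_i)_{i\in\omega}\in\{0,1\}^{\omega}:\exists m\ \forall i\ge m\ x_i=0\}$ with the ultrametric $D(\vec x,\vec y)=\max_{n\in\omega}2^n|x_n-y_n|$.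 A map $f:X\to Y$ between metric spaces is bornologous if for every real $\varepsilon$ there is a real $\delta$ such that $\mathrm{dist}(x,x')\le\varepsilon$ implies $\mathrm{dist}(f(x),f(x'))\le\delta$. Metric spaces $X,Y$ are coarsely equivalent if there are bornologous maps $f:X\to Y$, $g:Y\to X$ with $\sup_{x\in X}\mathrm{dist}(g(f(x)),x)<\infty$ and $\sup_{y\in Y}\mathrm{dist}(f(g(y)),y)<\infty$. *)

theory Defs
  imports "HOL-Analysis.Analysis"
begin

locale Proper_metric_space = Metric_space +
  assumes unbounded: "\<not> mbounded M"
    and compactin_mcball: "\<And>x r. x \<in> M \<Longrightarrow> compactin mtopology (mcball x r)"

locale Ultrametric_space = Metric_space +
  assumes ultrametric: "\<And>x y z. \<lbrakk>x \<in> M; y \<in> M; z \<in> M\<rbrakk> \<Longrightarrow> d x y \<le> max (d x z) (d z y)"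


text \<open>All infinite cardinalities are identified with \<open>\<infinity>\<close>.\<close>

definition ecard :: "'a set \<Rightarrow> enat" where
  "ecard A = (if finite A then enat (card A) else \<infinity>)"

context Metric_space
begin

definition eps_net :: "real \<Rightarrow> 'a set \<Rightarrow> 'a set \<Rightarrow> bool" where
  "eps_net \<epsilon> B N \<longleftrightarrow> N \<subseteq> B \<and> (\<forall>x\<in>B. \<exists>y\<in>N. d x y < \<epsilon>)"

definition Ent :: "real \<Rightarrow> 'a set \<Rightarrow> enat" where
  "Ent \<epsilon> B = (INF N \<in> {N. eps_net \<epsilon> B N}. ecard N)"

definition Ent_sup :: "real \<Rightarrow> real \<Rightarrow> enat" where
  "Ent_sup \<epsilon> \<delta> = (SUP x\<in>M. Ent \<epsilon> (mcball x \<delta>))"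

text \<open>As \<^typ>\<open>enat\<close> is well-ordered, the infimum over a nonempty space is attained.\<close>

definition ent_min :: "real \<Rightarrow> real \<Rightarrow> enat" where
  "ent_min \<epsilon> \<delta> = (INF x\<in>M. Ent \<epsilon> (mcball x \<delta>))"

end


definition bornologous ::
    "'a set \<Rightarrow> ('a \<Rightarrow> 'a \<Rightarrow> real) \<Rightarrow> 'b set \<Rightarrow> ('b \<Rightarrow> 'b \<Rightarrow> real) \<Rightarrow> ('a \<Rightarrow> 'b) \<Rightarrow> bool" where
  "bornologous X dX Y dY f \<longleftrightarrow>
     f \<in> X \<rightarrow> Y \<and>
     (\<forall>\<epsilon>::real. \<exists>\<delta>::real. \<forall>x\<in>X. \<forall>x'\<in>X. dX x x' \<le> \<epsilon> \<longrightarrow> dY (f x) (f x') \<le> \<delta>)"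

definition coarsely_equivalent ::
    "'a set \<Rightarrow> ('a \<Rightarrow> 'a \<Rightarrow> real) \<Rightarrow> 'b set \<Rightarrow> ('b \<Rightarrow> 'b \<Rightarrow> real) \<Rightarrow> bool" where
  "coarsely_equivalent X dX Y dY \<longleftrightarrow>
     (\<exists>f g. bornologous X dX Y dY f \<and> bornologous Y dY X dX g \<and>
            bdd_above ((\<lambda>x. dX (g (f x)) x) ` X) \<and>
            bdd_above ((\<lambda>y. dY (f (g y)) y) ` Y))"


definition anti_cantor :: "(nat \<Rightarrow> int) set" where
  "anti_cantor = {x. (\<forall>i. x i \<in> {0, 1}) \<and> (\<exists>m. \<forall>i\<ge>m. x i = 0)}"

text \<open>
  For two points of \<^const>\<open>anti_cantor\<close> the set under \<^const>\<open>Max\<close> is finite. The value \<open>0\<close>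
  elsewhere is a convention: \<^locale>\<open>Metric_space\<close> asks for a nonnegative symmetric
  function on the whole type.
\<close>

definition anti_cantor_dist :: "(nat \<Rightarrow> int) \<Rightarrow> (nat \<Rightarrow> int) \<Rightarrow> real" where
  "anti_cantor_dist x y =
     (if x \<in> anti_cantor \<and> y \<in> anti_cantor
      then Max (range (\<lambda>n. 2 ^ n * real_of_int \<bar>x n - y n\<bar>)) else 0)"

lemma finite_range_anti_cantor_dist:
  assumes "x \<in> anti_cantor" "y \<in> anti_cantor"
  shows "finite (range (\<lambda>n. 2 ^ n * real_of_int \<bar>x n - y n\<bar>))"
proof -
  obtain k l where "\<forall>i\<ge>k. x i = 0" "\<forall>i\<ge>l. y i = 0"
    using assms by (auto simp: anti_cantor_def)
  then have "2 ^ n * real_of_int \<bar>x n - y n\<bar> = 0" if "n \<ge> max k l" for n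
    using that by simp
  then have "range (\<lambda>n. 2 ^ n * real_of_int \<bar>x n - y n\<bar>) \<subseteq>
      insert 0 ((\<lambda>n. 2 ^ n * real_of_int \<bar>x n - y n\<bar>) ` {..<max k l})"
    by (metis (no_types, lifting) image_eqI image_subsetI insertCI lessThan_iff linorder_not_less)
  then show ?thesis
    by (rule finite_subset) simp
qed

lemma anti_cantor_dist_ge:
  assumes "x \<in> anti_cantor" "y \<in> anti_cantor"
  shows "2 ^ n * real_of_int \<bar>x n - y n\<bar> \<le> anti_cantor_dist x y"
  using finite_range_anti_cantor_dist[OF assms] assms by (simp add: anti_cantor_dist_def)

lemma anti_cantor_dist_attained:
  assumes "x \<in> anti_cantor" "y \<in> anti_cantor"
  obtains n where "anti_cantor_dist x y = 2 ^ n * real_of_int \<bar>x n - y n\<bar>"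
  using Max_in[OF finite_range_anti_cantor_dist[OF assms]] assms
  by (auto simp: anti_cantor_dist_def)

lemma anti_cantor_dist_nonneg: "0 \<le> anti_cantor_dist x y"
proof (cases "x \<in> anti_cantor \<and> y \<in> anti_cantor")
  case True
  then show ?thesis
    using anti_cantor_dist_attained[of x y] by (metis abs_ge_zero mult_nonneg_nonneg of_int_0_le_iff zero_le_numeral zero_le_power)
qed (auto simp: anti_cantor_dist_def)

lemma anti_cantor_dist_ultrametric:
  assumes "x \<in> anti_cantor" "y \<in> anti_cantor" "z \<in> anti_cantor"
  shows "anti_cantor_dist x y \<le> max (anti_cantor_dist x z) (anti_cantor_dist z y)"
proof -
  obtain n where n: "anti_cantor_dist x y = 2 ^ n * real_of_int \<bar>x n - y n\<bar>"
    using anti_cantor_dist_attained assms by blast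
  have "x n \<in> {0, 1}" "y n \<in> {0, 1}" "z n \<in> {0, 1}"
    using assms by (auto simp: anti_cantor_def)
  then have "\<bar>x n - y n\<bar> \<le> \<bar>x n - z n\<bar> \<or> \<bar>x n - y n\<bar> \<le> \<bar>z n - y n\<bar>"
    by auto
  then have "anti_cantor_dist x y \<le> 2 ^ n * real_of_int \<bar>x n - z n\<bar> \<or>
      anti_cantor_dist x y \<le> 2 ^ n * real_of_int \<bar>z n - y n\<bar>"
    unfolding n by (meson mult_left_mono of_int_le_iff zero_le_numeral zero_le_power)
  then show ?thesis
    using anti_cantor_dist_ge[OF assms(1,3), of n] anti_cantor_dist_ge[OF assms(3,2), of n]
    by linarith
qed

interpretation anti_cantor: Ultrametric_space anti_cantor anti_cantor_dist
proof
  fix x y z :: "nat \<Rightarrow> int"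
  show "0 \<le> anti_cantor_dist x y"
    by (rule anti_cantor_dist_nonneg)
  show "anti_cantor_dist x y = anti_cantor_dist y x"
    by (auto simp: anti_cantor_dist_def abs_minus_commute)
  assume x: "x \<in> anti_cantor" and y: "y \<in> anti_cantor"
  show "anti_cantor_dist x y = 0 \<longleftrightarrow> x = y"
  proof
    assume "anti_cantor_dist x y = 0"
    then have "2 ^ n * real_of_int \<bar>x n - y n\<bar> \<le> 0" for n
      using anti_cantor_dist_ge[OF x y, of n] by simp
    then show "x = y"
      by (auto simp: fun_eq_iff zero_less_mult_iff simp flip: not_less)
  next
    assume "x = y"
    then show "anti_cantor_dist x y = 0"
      using anti_cantor_dist_attained[OF x y] by auto
  qed
  assume z: "z \<in> anti_cantor"
  show "anti_cantor_dist x y \<le> max (anti_cantor_dist x z) (anti_cantor_dist z y)"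
    by (rule anti_cantor_dist_ultrametric[OF x y z])
  have "anti_cantor_dist x z \<le> max (anti_cantor_dist x y) (anti_cantor_dist y z)"
    by (rule anti_cantor_dist_ultrametric[OF x z y])
  then show "anti_cantor_dist x z \<le> anti_cantor_dist x y + anti_cantor_dist y z"
    using anti_cantor_dist_nonneg[of x y] anti_cantor_dist_nonneg[of y z] by linarith
qed


text \<open>
  For factors at least \<open>1\<close>, possibly infinite, \<^const>\<open>prodinf\<close> on \<^typ>\<open>ennreal\<close> always
  denotes the limit of the partial products, so its being finite is a meaningful hypothesis.
\<close>

lemma prodinf_ennreal_eq_SUP:
  fixes f :: "nat \<Rightarrow> ennreal"
  assumes "\<And>n. 1 \<le> f n"
  shows "prodinf f = (SUP n. \<Prod>i\<le>n. f i)"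
proof -
  have inc: "incseq (\<lambda>n. \<Prod>i\<le>n. f i)"
  proof (rule incseq_SucI)
    fix n
    show "(\<Prod>i\<le>n. f i) \<le> (\<Prod>i\<le>Suc n. f i)"
      using mult_left_mono[OF assms[of "Suc n"], of "\<Prod>i\<le>n. f i"] by simp
  qed
  have lim: "(\<lambda>n. \<Prod>i\<le>n. f i) \<longlonglongrightarrow> (SUP n. \<Prod>i\<le>n. f i)"
    using inc by (rule LIMSEQ_SUP)
  have "f 0 \<le> (SUP n. \<Prod>i\<le>n. f i)"
    by (rule SUP_upper2[of 0]) auto
  then have nz: "(SUP n. \<Prod>i\<le>n. f i) \<noteq> 0"
    using assms[of 0] by auto
  have f0: "f i \<noteq> 0" for i
    using assms[of i] by auto
  have "f has_prod p \<longleftrightarrow> p = (SUP n. \<Prod>i\<le>n. f i)" for p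
  proof
    assume "f has_prod p"
    then have "(\<lambda>n. \<Prod>i\<le>n. f i) \<longlonglongrightarrow> p"
      using f0 by (simp add: has_prod_def raw_has_prod_def)
    then show "p = (SUP n. \<Prod>i\<le>n. f i)"
      using lim by (rule LIMSEQ_unique)
  next
    assume "p = (SUP n. \<Prod>i\<le>n. f i)"
    then show "f has_prod p"
      using lim nz by (simp add: has_prod_def raw_has_prod_def)
  qed
  then show ?thesis
    by (simp add: prodinf_def)
qed

end

theory Submission
  imports Defs
begin

text \<open>
  Pick one point in every open ball of radius \<open>r 0\<close>; call the set of these points \<open>N\<close> and the
  number of points of \<open>N\<close> in a ball its volume. In an ultrametric space the closed balls of a fixed
  radius partition the space, so \<open>N\<close> carries a tower of partitions into finite classes. The natural
  numbers carry the tower of dyadic blocks, the sets on which \<open>y div 2 ^ k\<close> is constant, and binary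
  digits turn this into the tower of balls of the anti-Cantor set. It suffices to find a surjection
  \<open>N \<rightarrow> nat\<close> that matches the two towers up to a shift of levels: then it, and any right inverse of
  it, are bornologous, and the two compositions are close to the identity
  (\<open>coarsely_equivalent_by_surjection\<close>).

  The finite product enters through two consequences (\<open>entropy_of_finite_product\<close>). Every numerator
  is finite, so the volumes of balls of a fixed radius are uniformly bounded (\<open>vol_bounded\<close>). The
  factors tend to \<open>1\<close>, so they are eventually below \<open>2\<close>, and from then on a denominator \<open>1\<close> forces
  the numerator to be \<open>1\<close>. If this happened at all large scales, balls would stop growing, against
  unboundedness. Hence infinitely often every ball of radius \<open>r (Suc n)\<close> contains at least two balls
  of radius \<open>r n\<close>, and volumes tend to infinity uniformly in the centre (\<open>vol_unbounded\<close>). After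
  thinning out the scales and choosing block lengths \<open>B n\<close> between them, one obtains
  \<open>B n \<lless> volume at scale n \<lless> B (Suc n)\<close>, with gaps that grow geometrically in \<open>n\<close>
  (\<open>separated_scales\<close>).

  The core is then combinatorial (\<open>block_tower\<close>). A class of level \<open>n\<close> is to be mapped onto a set
  \<open>D\<close> of blocks of length \<open>B n\<close>. Rounding is unavoidable, because volumes need not be divisible by
  \<open>B n\<close>; therefore the statement proved by induction (\<open>fills_exists\<close>) admits every \<open>D\<close> whose total
  length is, up to a factor in a fixed window, the volume of the class. At level \<open>Suc n\<close> the subclasses
  of level \<open>n\<close> are first distributed evenly over the blocks of length \<open>B (Suc n)\<close>, which works
  because each is much smaller than such a block. Then the blocks of length \<open>B n\<close> inside one long
  block are distributed over the subclasses assigned to it, which works because they are much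
  shorter than each subclass is large. Each level narrows the window by an amount
  inversely proportional to the gap, and these amounts are summable, so the window never closes.

  There is no top level at which to begin, but the map on one subclass may be prescribed
  (\<open>fills_extend\<close>). Hence maps on the increasing classes of one base point can be chosen
  to extend each other, and their union is the surjection (\<open>interleaved_surjection\<close>).
\<close>

section \<open>Balanced distributions of finite weights\<close>

text \<open>
  Greedy balancing: each new item goes to a currently lightest bin, so no bin ever exceeds another
  by more than the weight \<open>W\<close> that a single item may have.
\<close>

lemma balanced_bins:
  fixes w :: "'a \<Rightarrow> real"
  assumes "finite A" "finite D" "D \<noteq> {}" "\<And>a. a \<in> A \<Longrightarrow> 0 \<le> w a \<and> w a \<le> W" "0 \<le> W"
  shows "\<exists>q. q ` A \<subseteq> D \<and>
    (\<forall>g\<in>D. \<forall>h\<in>D. sum w {a\<in>A. q a = g} \<le> sum w {a\<in>A. q a = h} + W)"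
  using assms(1,4)
proof (induction A)
  case empty
  show ?case using \<open>0 \<le> W\<close> by (intro exI[of _ undefined]) simp
next
  case (insert a A)
  have "\<exists>q. q ` A \<subseteq> D \<and>
    (\<forall>g\<in>D. \<forall>h\<in>D. sum w {a\<in>A. q a = g} \<le> sum w {a\<in>A. q a = h} + W)"
    using insert.IH insert.prems by simp
  then obtain q where q: "q ` A \<subseteq> D" and bal':
    "\<forall>g\<in>D. \<forall>h\<in>D. sum w {a\<in>A. q a = g} \<le> sum w {a\<in>A. q a = h} + W"
    by (elim exE conjE)
  note bal = bal'[rule_format]
  define load where "load g = sum w {a\<in>A. q a = g}" for g
  define m where "m = arg_min_on load D"
  have "m \<in> D" "load m \<le> load g" if "g \<in> D" for g
    unfolding m_def using arg_min_if_finite(1)[OF assms(2,3)] arg_min_least[OF assms(2,3) that] by auto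
  then have m: "m \<in> D" "\<And>g. g \<in> D \<Longrightarrow> sum w {a\<in>A. q a = m} \<le> sum w {a\<in>A. q a = g}"
    using assms(3) by (auto simp: load_def)
  define q' where "q' = q(a := m)"
  have *: "sum w {b\<in>insert a A. q' b = g} = (if g = m then w a else 0) + sum w {b\<in>A. q b = g}" for g
  proof -
    have "{b\<in>insert a A. q' b = g} = (if g = m then insert a {b\<in>A. q b = g} else {b\<in>A. q b = g})"
      using insert.hyps by (auto simp: q'_def)
    then show ?thesis using insert.hyps by auto
  qed
  have "q' ` insert a A \<subseteq> D" using q m insert.hyps by (auto simp: q'_def)
  moreover have "sum w {b\<in>insert a A. q' b = g} \<le> sum w {b\<in>insert a A. q' b = h} + W"
    if "g \<in> D" "h \<in> D" for g h
    using bal[OF that] m(2)[OF that(2)] insert.prems[of a] \<open>0 \<le> W\<close> unfolding * by auto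
  ultimately show ?case by blast
qed

lemma equal_bins:
  fixes w :: "'a \<Rightarrow> real"
  assumes "finite A" "finite D" "D \<noteq> {}" "\<And>a. a \<in> A \<Longrightarrow> 0 \<le> w a \<and> w a \<le> W" "0 \<le> W"
  shows "\<exists>q. q ` A \<subseteq> D \<and> (\<forall>g\<in>D. \<bar>sum w {a\<in>A. q a = g} - sum w A / card D\<bar> \<le> W)"
proof -
  have "\<exists>q. q ` A \<subseteq> D \<and>
    (\<forall>g\<in>D. \<forall>h\<in>D. sum w {a\<in>A. q a = g} \<le> sum w {a\<in>A. q a = h} + W)"
    by (rule balanced_bins) (use assms in auto)
  then obtain q where q: "q ` A \<subseteq> D" and bal':
    "\<forall>g\<in>D. \<forall>h\<in>D. sum w {a\<in>A. q a = g} \<le> sum w {a\<in>A. q a = h} + W"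
    by (elim exE conjE)
  note bal = bal'[rule_format]
  have tot: "(\<Sum>h\<in>D. sum w {a\<in>A. q a = h}) = sum w A"
    using sum.group[OF assms(1,2) q] by simp
  have pos: "real (card D) > 0" using assms by (simp add: card_gt_0_iff)
  have "\<bar>sum w {a\<in>A. q a = g} - sum w A / card D\<bar> \<le> W" if g: "g \<in> D" for g
  proof -
    have "real (card D) * sum w {a\<in>A. q a = g} \<le> (\<Sum>h\<in>D. sum w {a\<in>A. q a = h} + W)"
      by (rule sum_bounded_below) (use bal g in auto)
    then have 1: "real (card D) * sum w {a\<in>A. q a = g} \<le> sum w A + card D * W"
      by (simp add: sum.distrib tot)
    have "(\<Sum>h\<in>D. sum w {a\<in>A. q a = h}) \<le> real (card D) * (sum w {a\<in>A. q a = g} + W)"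
      by (rule sum_bounded_above) (use bal g in auto)
    then have 2: "sum w A \<le> real (card D) * (sum w {a\<in>A. q a = g} + W)"
      by (simp add: tot)
    show ?thesis using 1 2 pos by (simp add: abs_le_iff field_simps)
  qed
  then show ?thesis using q by blast
qed

text \<open>
  Serve the members of \<open>G\<close> one after the other; each takes as little as allowed, unless the upper
  quotas of those still waiting could not absorb the remainder.
\<close>

lemma distribute_with_quotas:
  fixes lo hi :: "'a \<Rightarrow> nat"
  assumes "finite G" "finite S" "\<And>a. a \<in> G \<Longrightarrow> lo a \<le> hi a"
    "sum lo G \<le> card S" "card S \<le> sum hi G"
  shows "\<exists>p. p ` S \<subseteq> G \<and> (\<forall>a\<in>G. lo a \<le> card {s\<in>S. p s = a} \<and> card {s\<in>S. p s = a} \<le> hi a)"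
  using assms
proof (induction G arbitrary: S)
  case empty
  then show ?case by simp
next
  case (insert a G)
  \<comment> \<open>the smallest share of \<open>a\<close> that leaves no more than the others can take\<close>
  define k where "k = max (lo a) (card S - sum hi G)"
  have k: "lo a \<le> k" "k \<le> hi a" "k \<le> card S" "sum lo G \<le> card S - k" "card S - k \<le> sum hi G"
    using insert.prems insert.hyps sum_mono[of G lo hi] unfolding k_def by auto
  obtain T where T: "T \<subseteq> S" "card T = k"
    using obtain_subset_with_card_n[OF k(3)] by metis
  have cST: "card (S - T) = card S - k"
    using T insert.prems(1) by (simp add: card_Diff_subset finite_subset)
  obtain p where p: "p ` (S - T) \<subseteq> G"
    "\<And>b. b \<in> G \<Longrightarrow> lo b \<le> card {s\<in>S - T. p s = b} \<and> card {s\<in>S - T. p s = b} \<le> hi b"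
    using insert.IH[of "S - T"] insert.prems k cST by auto
  define p' where "p' s = (if s \<in> T then a else p s)" for s
  have "p' ` S \<subseteq> insert a G" using p(1) by (auto simp: p'_def)
  moreover have "{s\<in>S. p' s = a} = T" using p(1) insert.hyps T by (auto simp: p'_def)
  moreover have "{s\<in>S. p' s = b} = {s\<in>S - T. p s = b}" if "b \<in> G" for b
    using that insert.hyps by (auto simp: p'_def)
  ultimately show ?case using p(2) k T
    by (intro exI[of _ p']) (auto simp del: Diff_iff)
qed

text \<open>
  The two estimates that govern the window of admissible densities. A block of length \<open>B'\<close> has to
  be filled at density \<open>d\<close>, so the ideal volume for it is \<open>s = B' / d\<close>; the volume \<open>w\<close> really
  assigned deviates by at most two error terms \<open>V\<close>, and up to \<open>B' * e / 8\<close> of the block may be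
  occupied in advance. If the density \<open>d\<close> lies in the window narrowed by \<open>e / 2\<close>, then filling
  at the extreme densities of the wider window, with a further rounding error \<open>e / 8\<close>, gives at
  most what is free, respectively at least the whole block.
\<close>

lemma lower_quota_arith:
  fixes s V B' a e d w :: real
  assumes "0 < e" "e \<le> 1/8" "a = 3/8 - e" "d \<ge> 3/8 - e / 2" "d \<le> 1" "0 < B'" "s * d = B'"
    "V \<le> e / 8 * B'" "w \<le> s + V" "0 \<le> w"
  shows "w * (a + e / 8) \<le> B' * (1 - e / 8)"
proof -
  have B': "B' = s * d" using assms by simp
  have d: "d > 0" using assms by linarith
  have s: "s > 0" using assms(6,7) d by (metis zero_less_mult_pos2)
  have "s * d \<le> s" using mult_left_mono[OF assms(5), of s] s by simp
  then have "e / 8 * (s * d) \<le> e / 8 * s" using assms(1) by (intro mult_left_mono) auto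
  then have "V \<le> e / 8 * s" using assms(8) unfolding B' by linarith
  then have "w \<le> s * (1 + e / 8)" using assms by (simp add: algebra_simps)
  then have "w * (a + e / 8) \<le> s * (1 + e / 8) * (a + e / 8)"
    by (rule mult_right_mono) (use assms in auto)
  moreover have "(1 + e / 8) * (a + e / 8) \<le> d * (1 - e / 8)"
  proof -
    have "(3/8 - e / 2) * (1 - e / 8) \<le> d * (1 - e / 8)"
      by (rule mult_right_mono) (use assms in auto)
    moreover have "(1 + e / 8) * (a + e / 8) \<le> (3/8 - e / 2) * (1 - e / 8)"
    proof -
      have "(3/8 - e / 2) * (1 - e / 8) - (1 + e / 8) * (a + e / 8) = e * (9/32 + e * 11/64)"
        unfolding assms(3) by (simp add: field_simps power2_eq_square)
      moreover have "0 \<le> e * (9/32 + e * 11/64)" using assms by auto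
      ultimately show ?thesis by linarith
    qed
    ultimately show ?thesis by linarith
  qed
  then have "s * ((1 + e / 8) * (a + e / 8)) \<le> s * (d * (1 - e / 8))"
    using s by (intro mult_left_mono) auto
  ultimately show ?thesis unfolding B' mult.assoc by linarith
qed

lemma upper_quota_arith:
  fixes s V B' b e d w :: real
  assumes "0 < e" "e \<le> 1/8" "b = 7/8 + e" "0 < d" "d \<le> 7/8 + e / 2" "0 < B'" "s * d = B'"
    "V \<le> e / 8 * B'" "s - 2 * V \<le> w"
  shows "B' \<le> w * (b - e / 8)"
proof -
  have B': "B' = s * d" using assms by simp
  have s: "s > 0" using assms(4,6,7) by (metis zero_less_mult_pos2)
  have "s * d \<le> s" using mult_left_mono[of d 1 s] s assms(2,5) by simp
  then have "e / 8 * (s * d) \<le> e / 8 * s" using assms(1) by (intro mult_left_mono) auto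
  then have "V \<le> e / 8 * s" using assms(8) unfolding B' by linarith
  then have "s * (1 - e / 4) \<le> w" using assms by (simp add: algebra_simps)
  then have "s * (1 - e / 4) * (b - e / 8) \<le> w * (b - e / 8)"
    by (rule mult_right_mono) (use assms in auto)
  moreover have "d \<le> (1 - e / 4) * (b - e / 8)"
  proof -
    have "(1 - e / 4) * (b - e / 8) - (7/8 + e / 2) = e * (5/32 - e * 7/32)"
      unfolding assms(3) by (simp add: field_simps power2_eq_square)
    moreover have "0 \<le> e * (5/32 - e * 7/32)" using assms by auto
    ultimately show ?thesis using assms by linarith
  qed
  then have "s * d \<le> s * ((1 - e / 4) * (b - e / 8))"
    using s by (intro mult_left_mono) auto
  ultimately show ?thesis unfolding B' mult.assoc by linarith
qed

section \<open>Transferring a tower of finite classes to blocks of natural numbers\<close>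

text \<open>
  The classes \<open>c n x\<close> form an increasing tower of partitions of \<open>X\<close>. The factor \<open>2 ^ (n + 6)\<close> fixes
  the relative error of level \<open>n\<close>: at each end the density window may lose four such errors,
  and over all levels these losses add up to at most \<open>1/8\<close> (see \<open>tol\<close> below).
\<close>

locale block_tower =
  fixes X :: "'a set" and c :: "nat \<Rightarrow> 'a \<Rightarrow> 'a set" and B :: "nat \<Rightarrow> nat"
  assumes c_self: "x \<in> X \<Longrightarrow> x \<in> c n x"
    and c_sub: "x \<in> X \<Longrightarrow> c n x \<subseteq> X"
    and c_eq: "x \<in> X \<Longrightarrow> y \<in> c n x \<Longrightarrow> c n y = c n x"
    and c_Suc: "x \<in> X \<Longrightarrow> c n x \<subseteq> c (Suc n) x"
    and c_exhaust: "x \<in> X \<Longrightarrow> y \<in> X \<Longrightarrow> \<exists>n. y \<in> c n x"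
    and c_finite: "x \<in> X \<Longrightarrow> finite (c n x)"
    and B_0: "B 0 = 1"
    and B_pos: "0 < B n"
    and B_dvd: "B n dvd B (Suc n)"
    and block_ll_class: "x \<in> X \<Longrightarrow> 2 ^ (n + 6) * B n \<le> card (c n x)"
    and class_ll_block: "x \<in> X \<Longrightarrow> 2 ^ (n + 6) * card (c n x) \<le> B (Suc n)"
begin

text \<open>
  At level \<open>n\<close> the density, total length of the blocks divided by size of the class, may range over
  \<open>[3/8 - tol n, 7/8 + tol n]\<close>. This is \<open>[1/4, 1]\<close> at level \<open>0\<close>, where density at most \<open>1\<close> is what a
  surjection needs, and it always contains \<open>[3/8, 7/8]\<close>. The relative error of level \<open>n\<close> is
  \<open>tol n / 8\<close>, and passing to level \<open>Suc n\<close> narrows the window by four of these at each end.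
\<close>

definition tol :: "nat \<Rightarrow> real" where "tol n = 1 / (8 * 2 ^ n)"

definition fits :: "nat \<Rightarrow> 'a set \<Rightarrow> nat set \<Rightarrow> bool" where
  "fits n C D \<longleftrightarrow> finite D \<and> (3/8 - tol n) * card C \<le> card D * B n \<and>
     card D * B n \<le> (7/8 + tol n) * card C"

text \<open>
  The class \<open>C\<close> of level \<open>n\<close> is mapped onto the blocks with indices in \<open>D\<close> such that below level \<open>n\<close>
  the two towers interleave: the preimage of a block of length \<open>B i\<close> lies in one class of level \<open>i\<close>,
  and the image of that class lies in one block of length \<open>B (Suc i)\<close>.
\<close>

definition fills :: "nat \<Rightarrow> 'a set \<Rightarrow> nat set \<Rightarrow> ('a \<Rightarrow> nat) \<Rightarrow> bool" where
  "fills n C D f \<longleftrightarrow> f ` C = {y. y div B n \<in> D} \<and>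
     (\<forall>i<n. \<forall>x\<in>C. \<forall>y\<in>c i x. f x div B (Suc i) = f y div B (Suc i)) \<and>
     (\<forall>i\<le>n. \<forall>x\<in>C. \<forall>y\<in>C. f x div B i = f y div B i \<longrightarrow> c i x = c i y)"

definition ratio :: "nat \<Rightarrow> nat" where "ratio n = B (Suc n) div B n"

lemma B_Suc: "B (Suc n) = B n * ratio n"
  using B_dvd by (simp add: ratio_def)

lemma ratio_pos: "0 < ratio n"
  using B_pos[of "Suc n"] by (simp add: B_Suc)

lemma div_B_Suc: "y div B (Suc n) = y div B n div ratio n"
  by (simp add: B_Suc div_mult2_eq)

lemma B_dvd_le: "i \<le> n \<Longrightarrow> B i dvd B n"
  by (induction n rule: dec_induct) (simp, metis B_dvd dvd_trans)

lemma div_B_mono: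
  assumes "i \<le> n" "y div B i = z div B i"
  shows "y div B n = z div B n"
proof -
  obtain k where "B n = B i * k" using B_dvd_le[OF assms(1)] by (elim dvdE)
  then show ?thesis using assms(2) by (simp add: div_mult2_eq)
qed

lemma subblocks: "{m. m div ratio n = g} = {g * ratio n..<g * ratio n + ratio n}"
proof (intro set_eqI iffI)
  fix m assume "m \<in> {m. m div ratio n = g}"
  then have "g * ratio n + m mod ratio n = m" using div_mult_mod_eq[of m "ratio n"] by simp
  moreover have "m mod ratio n < ratio n" by (rule mod_less_divisor[OF ratio_pos])
  ultimately show "m \<in> {g * ratio n..<g * ratio n + ratio n}"
    unfolding atLeastLessThan_iff by linarith
next
  fix m assume "m \<in> {g * ratio n..<g * ratio n + ratio n}"
  then show "m \<in> {m. m div ratio n = g}"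
    by (auto intro!: div_nat_eqI simp: mult.commute[of g])
qed

lemma tol_bounds: "0 < tol n" "tol n \<le> 1/8" "tol (Suc n) = tol n / 2"
  by (simp_all add: tol_def)

lemma block_le_tol_class:
  assumes "x \<in> X"
  shows "real (B n) \<le> tol n / 8 * card (c n x)"
proof -
  have "real (2 ^ (n + 6) * B n) \<le> real (card (c n x))"
    by (rule of_nat_mono) (rule block_ll_class[OF assms])
  then have "64 * 2 ^ n * real (B n) \<le> real (card (c n x))" by (simp add: power_add mult.commute)
  then show ?thesis by (simp add: tol_def pos_le_divide_eq mult.commute)
qed

lemma class_le_tol_block:
  assumes "x \<in> X"
  shows "real (card (c n x)) \<le> tol n / 8 * B (Suc n)"
proof -
  have "real (2 ^ (n + 6) * card (c n x)) \<le> real (B (Suc n))"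
    by (rule of_nat_mono) (rule class_ll_block[OF assms])
  then have "64 * 2 ^ n * real (card (c n x)) \<le> real (B (Suc n))" by (simp add: power_add mult.commute)
  then show ?thesis by (simp add: tol_def pos_le_divide_eq mult.commute)
qed

lemma c_mono:
  assumes "x \<in> X" "i \<le> n"
  shows "c i x \<subseteq> c n x"
  using assms(2) by (induction n rule: dec_induct) (use c_Suc[OF assms(1)] in blast)+

lemma c_disjoint:
  assumes "x \<in> X" "y \<in> X" "z \<in> c n x" "z \<in> c n y"
  shows "c n x = c n y"
  by (rule trans[OF c_eq[OF assms(1,3), symmetric] c_eq[OF assms(2,4)]])

lemma sum_card_children:
  assumes "x \<in> X"
  shows "(\<Sum>K\<in>c n ` c (Suc n) x. card K) = card (c (Suc n) x)"
proof -
  have sub: "y \<in> X" if "y \<in> c (Suc n) x" for y using that c_sub assms by blast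
  have "\<Union> (c n ` c (Suc n) x) = c (Suc n) x"
  proof (intro equalityI subsetI)
    fix z assume "z \<in> \<Union> (c n ` c (Suc n) x)"
    then obtain y where y: "y \<in> c (Suc n) x" "z \<in> c n y" by blast
    then have "z \<in> c (Suc n) y" using c_Suc[OF sub] by blast
    then show "z \<in> c (Suc n) x" using c_eq[OF assms y(1)] by simp
  next
    fix z assume "z \<in> c (Suc n) x"
    then show "z \<in> \<Union> (c n ` c (Suc n) x)" using c_self[OF sub] by blast
  qed
  moreover have "card (\<Union> (c n ` c (Suc n) x)) = (\<Sum>K\<in>c n ` c (Suc n) x. card K)"
  proof (rule card_Union_disjoint)
    show "pairwise disjnt (c n ` c (Suc n) x)"
      unfolding pairwise_def disjnt_def
    proof (intro ballI impI, elim imageE)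
      fix K L y z
      assume *: "K \<noteq> L" "K = c n y" "L = c n z" "y \<in> c (Suc n) x" "z \<in> c (Suc n) x"
      have "False" if "w \<in> K" "w \<in> L" for w
        using c_disjoint[OF sub[OF *(4)] sub[OF *(5)], of w n] that *(1) unfolding *(2,3) by simp
      then show "K \<inter> L = {}" by blast
    qed
  qed (use sub c_finite in auto)
  ultimately show ?thesis by simp
qed

lemma card_pos: "x \<in> X \<Longrightarrow> 0 < card (c n x)"
  using c_self[of x n] c_finite[of x n] by (metis card_gt_0_iff ex_in_conv of_nat_0_less_iff)

lemma card_le_block:
  assumes "x \<in> X"
  shows "card (c n x) \<le> B (Suc n)"
proof -
  have "card (c n x) \<le> 2 ^ (n + 6) * card (c n x)" by simp
  then show ?thesis using class_ll_block[OF assms] by (rule le_trans)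
qed

text \<open>
  The density \<open>7/8\<close>, rounded down, stays in the window. The number of blocks obtained is at most
  \<open>ratio n\<close>, so they find room in a single block of the next length.
\<close>

lemma fits_exists:
  assumes "x \<in> X"
  shows "\<exists>k. 0 < k \<and> k \<le> ratio n \<and> (\<forall>D. finite D \<longrightarrow> card D = k \<longrightarrow> fits n (c n x) D)"
proof -
  define k where "k = (7 * card (c n x)) div (8 * B n)"
  have Bn: "real (B n) \<le> tol n / 8 * card (c n x)" by (rule block_le_tol_class[OF assms])
  have cp: "0 < real (card (c n x))" using card_pos[OF assms] by simp
  have "k * (8 * B n) \<le> 7 * card (c n x)"
    unfolding k_def by (rule div_times_less_eq_dividend)
  then have "real (k * (8 * B n)) \<le> real (7 * card (c n x))" by (rule of_nat_mono)
  then have up: "real (k * B n) \<le> 7/8 * card (c n x)" by simp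
  have "7 * card (c n x) < 8 * B n + k * (8 * B n)"
    unfolding k_def using dividend_less_div_times[of "8 * B n" "7 * card (c n x)"] B_pos[of n]
    by (simp add: mult.commute)
  then have "real (7 * card (c n x)) < real (8 * B n + k * (8 * B n))" by (simp only: of_nat_less_iff)
  then have "7/8 * card (c n x) - B n \<le> real (k * B n)" by simp
  then have low: "(7/8 - tol n / 8) * card (c n x) \<le> real (k * B n)"
    using Bn by (simp add: algebra_simps)
  have "0 < (7/8 - tol n / 8) * card (c n x)" using tol_bounds(2)[of n] cp by simp
  then have "0 < real (k * B n)" using low by linarith
  then have k: "0 < k" by (cases "k = 0") simp_all
  have "real (k * B n) \<le> real (card (c n x))" using up cp by linarith
  then have "k * B n \<le> card (c n x)" by (simp only: of_nat_le_iff)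
  then have "k * B n \<le> ratio n * B n"
    using card_le_block[OF assms, of n] unfolding B_Suc mult.commute[of "B n"] by (rule le_trans)
  then have k': "k \<le> ratio n" using B_pos[of n] unfolding mult_le_cancel2 by blast
  have "fits n (c n x) D" if "finite D" "card D = k" for D
  proof -
    have "(3/8 - tol n) * card (c n x) \<le> (7/8 - tol n / 8) * card (c n x)"
      by (rule mult_right_mono) (use tol_bounds(1)[of n] in auto)
    moreover have "7/8 * card (c n x) \<le> (7/8 + tol n) * card (c n x)"
      by (rule mult_right_mono) (use tol_bounds(1)[of n] in auto)
    ultimately show ?thesis unfolding fits_def using that low up by auto
  qed
  then show ?thesis using k k' by blast
qed

lemma fills_base:
  assumes x: "x \<in> X" and fits: "fits 0 (c 0 x) D"
  shows "\<exists>f. fills 0 (c 0 x) D f"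
proof -
  have cp: "0 < real (card (c 0 x))" using card_pos[OF x] by simp
  have D: "finite D" "1/4 * real (card (c 0 x)) \<le> real (card D)" "real (card D) \<le> real (card (c 0 x))"
    using fits by (auto simp: fits_def B_0 tol_def)
  have "0 < real (card D)" using D(2) cp by linarith
  then obtain d where d: "d \<in> D" by (metis card_gt_0_iff ex_in_conv of_nat_0_less_iff)
  have "card D \<le> card (c 0 x)" using D(3) by simp
  then obtain g where g: "inj_on g D" "g ` D \<subseteq> c 0 x"
    using inj_on_iff_card_le[OF D(1) c_finite[OF x], of 0] by (elim iffD2[THEN exE] conjE)
  define f where "f z = (if z \<in> g ` D then inv_into D g z else d)" for z
  have image: "f ` c 0 x = D"
  proof (intro equalityI subsetI)
    fix e assume "e \<in> D"
    then have "f (g e) = e" "g e \<in> c 0 x" using g by (simp_all add: f_def image_subset_iff)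
    then show "e \<in> f ` c 0 x" by (intro image_eqI) (rule sym)
  next
    fix e assume "e \<in> f ` c 0 x"
    then show "e \<in> D" using d by (auto simp: f_def inv_into_into)
  qed
  have "fills 0 (c 0 x) D f"
    unfolding fills_def
  proof (intro conjI allI ballI impI)
    show "f ` c 0 x = {y. y div B 0 \<in> D}" by (simp add: image B_0)
    fix i :: nat and y z assume "i \<le> 0" "y \<in> c 0 x" "z \<in> c 0 x"
    then have "c i y = c 0 x" "c i z = c 0 x" using c_eq[OF x, of _ 0] by simp_all
    then show "c i y = c i z" by simp
  qed simp
  then show ?thesis by blast
qed

text \<open>
  The inductive step, on the level of counting: every subclass \<open>K\<close> of level \<open>n\<close> receives a long
  block \<open>Q K\<close> and a fitting set \<open>E K\<close> of short blocks inside it, and all short blocks are used exactly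
  once. For the subclass \<open>c n x\<close> the answer \<open>D0\<close> is prescribed, which makes extensions possible;
  \<open>D0\<close> is at most as long as \<open>c n x\<close> is large, so its presence costs one more relative
  error.
\<close>

lemma subblock_assignment:
  assumes x: "x \<in> X"
    and fits': "fits (Suc n) (c (Suc n) x) D'" and g0: "g0 \<in> D'"
    and fits0: "fits n (c n x) D0" and sub0: "D0 \<subseteq> {m. m div ratio n = g0}"
  shows "\<exists>E Q. Q ` c n ` c (Suc n) x \<subseteq> D' \<and> E (c n x) = D0 \<and>
    (\<forall>K\<in>c n ` c (Suc n) x. fits n K (E K) \<and> E K \<subseteq> {m. m div ratio n = Q K}) \<and>
    disjoint_family_on E (c n ` c (Suc n) x) \<and>
    (\<Union>K\<in>c n ` c (Suc n) x. E K) = {m. m div ratio n \<in> D'}"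
proof -
  define Ch where "Ch = c n ` c (Suc n) x"
  define A where "A = Ch - {c n x}"
  define C where "C = real (card (c (Suc n) x))"
  define B' where "B' = real (B (Suc n))"
  define e where "e = tol n"
  define V where "V = e / 8 * B'"
  define w where "w K = real (card K)" for K :: "'a set"
  have sub: "y \<in> X" if "y \<in> c (Suc n) x" for y using c_sub[OF x] that by blast
  have e: "0 < e" "e \<le> 1/8" "tol (Suc n) = e / 2" unfolding e_def by (rule tol_bounds)+
  have B': "0 < B'" unfolding B'_def using B_pos by simp
  have V0: "0 \<le> V" unfolding V_def using e B' by simp
  have C0: "0 < C" unfolding C_def using card_pos[OF x] by simp
  have finCh: "finite Ch" unfolding Ch_def using c_finite[OF x] by simp
  have c0Ch: "c n x \<in> Ch" unfolding Ch_def using c_self[OF x] by simp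
  have child: "\<exists>y\<in>X. K = c n y" if "K \<in> Ch" for K
    using that sub unfolding Ch_def by blast
  have wV: "w K \<le> V" if K: "K \<in> Ch" for K
  proof -
    obtain y where "y \<in> X" "K = c n y" using child[OF K] by blast
    then show ?thesis using class_le_tol_block[of y n] unfolding w_def V_def e_def B'_def by simp
  qed
  have wB: "real (B n) \<le> e / 8 * w K" if K: "K \<in> Ch" for K
  proof -
    obtain y where "y \<in> X" "K = c n y" using child[OF K] by blast
    then show ?thesis using block_le_tol_class[of y n] unfolding w_def e_def by simp
  qed
  have sumCh: "sum w Ch = C"
    unfolding Ch_def w_def C_def sum_card_children[OF x, symmetric] of_nat_sum ..
  then have sumA: "sum w A = C - w (c n x)"
    unfolding A_def by (simp add: sum_diff1 finCh c0Ch)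
  have finD': "finite D'" using fits' unfolding fits_def by blast
  have "card D' \<noteq> 0" using finD' g0 by auto
  then have tpos: "1 \<le> real (card D')" by linarith
  \<comment> \<open>\<open>s\<close> is the volume due to each long block, \<open>dens\<close> the density at which the blocks are filled\<close>
  define s where "s = C / card D'"
  define dens where "dens = card D' * B' / C"
  have sd: "s * dens = B'" unfolding s_def dens_def using C0 tpos by simp
  have dens: "3/8 - e / 2 \<le> dens" "dens \<le> 7/8 + e / 2"
    using fits' C0 unfolding fits_def dens_def B'_def C_def[symmetric] e(3)
    by (simp_all add: pos_le_divide_eq pos_divide_le_eq)
  then have dens': "0 < dens" "dens \<le> 1" using e by linarith+
  have "\<exists>q. q ` A \<subseteq> D' \<and> (\<forall>g\<in>D'. \<bar>sum w {K\<in>A. q K = g} - sum w A / card D'\<bar> \<le> V)"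
  proof (rule equal_bins)
    show "finite A" using finCh by (simp add: A_def)
    show "D' \<noteq> {}" using g0 by blast
    show "0 \<le> w K \<and> w K \<le> V" if "K \<in> A" for K using wV that by (simp add: A_def w_def)
  qed (use finD' V0 in auto)
  then obtain q where q: "q ` A \<subseteq> D'"
    and bal: "\<forall>g\<in>D'. \<bar>sum w {K\<in>A. q K = g} - sum w A / card D'\<bar> \<le> V" by (elim exE conjE)
  \<comment> \<open>leaving out the prescribed subclass lowers the average load by at most \<open>V\<close>\<close>
  have avg: "s - V \<le> sum w A / card D'" "sum w A / card D' \<le> s"
  proof -
    have "w (c n x) / card D' \<le> w (c n x)" using tpos by (simp add: divide_le_eq w_def mult_le_cancel_left1)
    moreover have "sum w A / card D' = s - w (c n x) / card D'"
      unfolding sumA s_def by (simp add: diff_divide_distrib)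
    moreover have "0 \<le> w (c n x) / card D'" by (simp add: w_def)
    ultimately show "s - V \<le> sum w A / card D'" "sum w A / card D' \<le> s" using wV[OF c0Ch] by linarith+
  qed
  \<comment> \<open>the short blocks of \<open>g\<close> still to be distributed; \<open>D0\<close> only affects \<open>g0\<close>\<close>
  define S where "S g = {m. m div ratio n = g} - D0" for g
  \<comment> \<open>the least and the greatest number of short blocks that fit the subclass \<open>K\<close>\<close>
  define lo where "lo K = nat \<lceil>(3/8 - e) * w K / B n\<rceil>" for K :: "'a set"
  define hi where "hi K = nat \<lfloor>(7/8 + e) * w K / B n\<rfloor>" for K :: "'a set"
  have Bn: "0 < real (B n)" using B_pos by simp
  have lo: "(3/8 - e) * w K \<le> real (lo K) * B n" "K \<in> Ch \<Longrightarrow> real (lo K) * B n \<le> w K * (3/8 - e + e / 8)" for K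
  proof -
    have nn: "0 \<le> (3/8 - e) * w K / B n" using e by (simp add: w_def)
    have "(3/8 - e) * w K / B n \<le> lo K" unfolding lo_def by (rule real_nat_ceiling_ge)
    then show "(3/8 - e) * w K \<le> real (lo K) * B n" using Bn by (simp add: pos_divide_le_eq)
    assume K: "K \<in> Ch"
    have "real (lo K) \<le> (3/8 - e) * w K / B n + 1"
      unfolding lo_def using nn by simp
    then have "real (lo K) * B n \<le> ((3/8 - e) * w K / B n + 1) * B n" using Bn by (intro mult_right_mono) auto
    also have "\<dots> = (3/8 - e) * w K + B n" using Bn by (simp add: distrib_right)
    also have "\<dots> \<le> w K * (3/8 - e + e / 8)" using wB[OF K] by (simp add: algebra_simps)
    finally show "real (lo K) * B n \<le> w K * (3/8 - e + e / 8)" by simp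
  qed
  have hi: "real (hi K) * B n \<le> (7/8 + e) * w K" "K \<in> Ch \<Longrightarrow> w K * (7/8 + e - e / 8) \<le> real (hi K) * B n" for K
  proof -
    have nn: "0 \<le> (7/8 + e) * w K / B n" using e by (simp add: w_def)
    have "real (hi K) \<le> (7/8 + e) * w K / B n" unfolding hi_def using nn by simp
    then show "real (hi K) * B n \<le> (7/8 + e) * w K" using Bn by (simp add: pos_le_divide_eq)
    assume K: "K \<in> Ch"
    have "real (hi K) = of_int \<lfloor>(7/8 + e) * w K / B n\<rfloor>" unfolding hi_def using nn by simp
    then have "(7/8 + e) * w K / B n - 1 \<le> real (hi K)"
      using real_of_int_floor_gt_diff_one[of "(7/8 + e) * w K / B n"] by linarith
    then have "((7/8 + e) * w K / B n - 1) * B n \<le> real (hi K) * B n" using Bn by (intro mult_right_mono) auto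
    moreover have "((7/8 + e) * w K / B n - 1) * B n = (7/8 + e) * w K - B n" using Bn by (simp add: left_diff_distrib)
    moreover have "w K * (7/8 + e - e / 8) \<le> (7/8 + e) * w K - B n" using wB[OF K] by (simp add: algebra_simps)
    ultimately show "w K * (7/8 + e - e / 8) \<le> real (hi K) * B n" by linarith
  qed
  have lohi: "lo K \<le> hi K" if "K \<in> Ch" for K
  proof -
    have "w K * (3/8 - e + e / 8) \<le> w K * (7/8 + e - e / 8)"
      by (rule mult_left_mono) (use e in \<open>auto simp: w_def\<close>)
    then have "real (lo K) * B n \<le> real (hi K) * B n"
      by (rule order_trans[OF lo(2)[OF that] order_trans[OF _ hi(2)[OF that]]])
    then show ?thesis using Bn by simp
  qed
  have finS: "finite (S g)" for g unfolding S_def subblocks by simp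
  have cardS: "real (card (S g)) * B n \<le> B'" "B' * (1 - e / 8) \<le> real (card (S g)) * B n" for g
  proof -
    have BB: "B' = real (ratio n) * B n" unfolding B'_def B_Suc by simp
    have "card (S g) \<le> ratio n"
      using card_mono[of "{g * ratio n..<g * ratio n + ratio n}" "S g"] unfolding S_def subblocks by auto
    then show "real (card (S g)) * B n \<le> B'" unfolding BB using Bn by (simp add: mult_right_mono)
    have "finite D0" "real (card D0) * B n \<le> (7/8 + e) * w (c n x)"
      using fits0 unfolding fits_def e_def w_def by auto
    moreover have "(7/8 + e) * w (c n x) \<le> 1 * w (c n x)"
      by (rule mult_right_mono) (use e in \<open>auto simp: w_def\<close>)
    ultimately have D0: "finite D0" "real (card D0) * B n \<le> e / 8 * B'"
      using wV[OF c0Ch] unfolding V_def by auto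
    have "ratio n - card D0 \<le> card (S g)"
      using diff_card_le_card_Diff[OF D0(1), of "{m. m div ratio n = g}"] unfolding S_def subblocks by simp
    then have "real (ratio n) - card D0 \<le> card (S g)" by linarith
    then have "(real (ratio n) - card D0) * B n \<le> real (card (S g)) * B n" using Bn by (intro mult_right_mono) auto
    moreover have "(real (ratio n) - card D0) * B n = B' - real (card D0) * B n"
      unfolding BB by (simp add: left_diff_distrib)
    ultimately show "B' * (1 - e / 8) \<le> real (card (S g)) * B n" using D0(2) by (simp add: right_diff_distrib mult.commute)
  qed
  define G where "G g = {K\<in>A. q K = g}" for g
  have GCh: "G g \<subseteq> Ch" for g by (auto simp: G_def A_def)
  have finG: "finite (G g)" for g using GCh finCh by (rule finite_subset)
  have "\<forall>g\<in>D'. \<exists>p. p ` S g \<subseteq> G g \<and>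
      (\<forall>K\<in>G g. lo K \<le> card {m\<in>S g. p m = K} \<and> card {m\<in>S g. p m = K} \<le> hi K)"
  proof (intro ballI distribute_with_quotas)
    fix g assume g: "g \<in> D'"
    show "finite (G g)" "finite (S g)" by (rule finG, rule finS)
    have W: "s - 2 * V \<le> sum w (G g)" "sum w (G g) \<le> s + V" "0 \<le> sum w (G g)"
      using bal[rule_format, OF g] avg unfolding G_def by (auto simp: abs_le_iff w_def intro: sum_nonneg)
    have "real (sum lo (G g)) * B n = (\<Sum>K\<in>G g. real (lo K) * B n)" by (simp add: sum_distrib_right)
    also have "\<dots> \<le> (\<Sum>K\<in>G g. w K * (3/8 - e + e / 8))"
      by (rule sum_mono) (use lo(2) GCh in auto)
    also have "\<dots> = sum w (G g) * (3/8 - e + e / 8)" by (simp add: sum_distrib_right)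
    also have "\<dots> \<le> B' * (1 - e / 8)"
      by (rule lower_quota_arith[OF e(1,2) refl dens(1) dens'(2) B' sd _ W(2,3)]) (simp add: V_def)
    also have "\<dots> \<le> real (card (S g)) * B n" using cardS(2) by simp
    finally show "sum lo (G g) \<le> card (S g)" using Bn by (simp del: of_nat_sum)
    have "real (card (S g)) * B n \<le> B'" using cardS(1) by simp
    also have "\<dots> \<le> sum w (G g) * (7/8 + e - e / 8)"
      by (rule upper_quota_arith[OF e(1,2) refl dens'(1) dens(2) B' sd _ W(1)]) (simp add: V_def)
    also have "\<dots> = (\<Sum>K\<in>G g. w K * (7/8 + e - e / 8))" by (simp add: sum_distrib_right)
    also have "\<dots> \<le> (\<Sum>K\<in>G g. real (hi K) * B n)"
      by (rule sum_mono) (use hi(2) GCh in auto)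
    also have "\<dots> = real (sum hi (G g)) * B n" by (simp add: sum_distrib_right)
    finally show "card (S g) \<le> sum hi (G g)" using Bn by (simp del: of_nat_sum)
    show "lo K \<le> hi K" if "K \<in> G g" for K by (rule lohi[OF subsetD[OF GCh that]])
  qed
  from bchoice[OF this] obtain p where p':
    "\<forall>g\<in>D'. p g ` S g \<subseteq> G g \<and>
      (\<forall>K\<in>G g. lo K \<le> card {m\<in>S g. p g m = K} \<and> card {m\<in>S g. p g m = K} \<le> hi K)"
    by (elim exE)
  have p1: "p g m \<in> G g" if "g \<in> D'" "m \<in> S g" for g m
    using p'[rule_format, OF that(1)] that(2) by blast
  have p2: "lo K \<le> card {m\<in>S g. p g m = K}" "card {m\<in>S g. p g m = K} \<le> hi K"
    if "g \<in> D'" "K \<in> G g" for g K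
    using p'[rule_format, OF that(1)] that(2) by blast+
  define Q where "Q K = (if K = c n x then g0 else q K)" for K
  define E where "E K = (if K = c n x then D0 else {m\<in>S (q K). p (q K) m = K})" for K
  have "Q ` Ch \<subseteq> D'" using q g0 by (auto simp: Q_def A_def)
  moreover have "E (c n x) = D0" by (simp add: E_def)
  moreover have "fits n K (E K) \<and> E K \<subseteq> {m. m div ratio n = Q K}" if K: "K \<in> Ch" for K
  proof (cases "K = c n x")
    case True
    then show ?thesis using fits0 sub0 by (simp add: E_def Q_def)
  next
    case False
    then have KA: "K \<in> A" using K by (simp add: A_def)
    then have KG: "q K \<in> D'" "K \<in> G (q K)" using q by (auto simp: G_def)
    define k where "k = card {m\<in>S (q K). p (q K) m = K}"
    have "lo K \<le> k" "k \<le> hi K" unfolding k_def by (rule p2[OF KG])+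
    then have "real (lo K) * B n \<le> real k * B n" "real k * B n \<le> real (hi K) * B n"
      using Bn by (auto intro: mult_right_mono)
    then have "(3/8 - e) * w K \<le> real k * B n" "real k * B n \<le> (7/8 + e) * w K"
      using lo(1)[of K] hi(1)[of K] by auto
    moreover have "finite {m\<in>S (q K). p (q K) m = K}" using finS[of "q K"] by simp
    moreover have "E K = {m\<in>S (q K). p (q K) m = K}" "Q K = q K"
      using False by (simp_all add: E_def Q_def)
    moreover have "{m\<in>S (q K). p (q K) m = K} \<subseteq> {m. m div ratio n = q K}"
      unfolding S_def by blast
    ultimately show ?thesis by (simp only: fits_def k_def e_def w_def of_nat_mult)
  qed
  moreover have "disjoint_family_on E Ch"
    unfolding disjoint_family_on_def
  proof (intro ballI impI)
    fix K L assume "K \<in> Ch" "L \<in> Ch" "K \<noteq> L"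
    then show "E K \<inter> E L = {}" by (auto simp: E_def S_def split: if_splits)
  qed
  moreover have "(\<Union>K\<in>Ch. E K) = {m. m div ratio n \<in> D'}"
  proof (intro equalityI subsetI)
    fix m assume "m \<in> (\<Union>K\<in>Ch. E K)"
    then obtain K where K: "K \<in> Ch" "m \<in> E K" by blast
    then show "m \<in> {m. m div ratio n \<in> D'}"
      using q sub0 g0 by (auto simp: E_def S_def A_def split: if_splits)
  next
    fix m assume m: "m \<in> {m. m div ratio n \<in> D'}"
    show "m \<in> (\<Union>K\<in>Ch. E K)"
    proof (cases "m \<in> D0")
      case True
      then have "m \<in> E (c n x)" by (simp add: E_def)
      then show ?thesis using c0Ch by blast
    next
      case False
      define g where "g = m div ratio n"
      have mS: "m \<in> S g" "g \<in> D'" using False m by (auto simp: S_def g_def)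
      then have pG: "p g m \<in> G g" by (intro p1)
      then have "p g m \<in> Ch" "m \<in> E (p g m)" using mS by (auto simp: G_def A_def E_def)
      then show ?thesis by blast
    qed
  qed
  ultimately show ?thesis unfolding Ch_def[symmetric] by blast
qed

lemma fillsD:
  assumes "fills n C D f"
  shows "f ` C = {y. y div B n \<in> D}"
    and "i < n \<Longrightarrow> x \<in> C \<Longrightarrow> y \<in> c i x \<Longrightarrow> f x div B (Suc i) = f y div B (Suc i)"
    and "i \<le> n \<Longrightarrow> x \<in> C \<Longrightarrow> y \<in> C \<Longrightarrow> f x div B i = f y div B i \<Longrightarrow> c i x = c i y"
  using assms unfolding fills_def by blast+

text \<open>
  Glue the maps of the subclasses. Since the sets \<open>E K\<close> are disjoint, the short block of an image
  point determines its subclass; since \<open>E K\<close> lies in one long block, each subclass is mapped into one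
  long block. Inside a subclass everything is inherited.
\<close>

lemma fills_extend:
  assumes x: "x \<in> X"
    and fits': "fits (Suc n) (c (Suc n) x) D'" and g0: "g0 \<in> D'"
    and fits0: "fits n (c n x) D0" and sub0: "D0 \<subseteq> {m. m div ratio n = g0}"
    and f0: "fills n (c n x) D0 f0"
    and IH: "\<And>y D. y \<in> X \<Longrightarrow> fits n (c n y) D \<Longrightarrow> \<exists>f. fills n (c n y) D f"
  shows "\<exists>f. fills (Suc n) (c (Suc n) x) D' f \<and> (\<forall>z\<in>c n x. f z = f0 z)"
proof -
  define C where "C = c (Suc n) x"
  obtain E Q where Q: "Q ` c n ` C \<subseteq> D'" and E0: "E (c n x) = D0"
    and EQ: "\<forall>K\<in>c n ` C. fits n K (E K) \<and> E K \<subseteq> {m. m div ratio n = Q K}"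
    and disj: "disjoint_family_on E (c n ` C)"
    and cover: "(\<Union>K\<in>c n ` C. E K) = {m. m div ratio n \<in> D'}"
    using subblock_assignment[OF x fits' g0 fits0 sub0] unfolding C_def by (elim exE conjE)
  have sub: "y \<in> X" if "y \<in> C" for y using c_sub[OF x] that unfolding C_def by blast
  have upper: "c (Suc n) y = C" if "y \<in> C" for y using c_eq[OF x] that unfolding C_def by simp
  have mem: "y \<in> c n y" if "y \<in> C" for y by (rule c_self[OF sub[OF that]])
  have down: "z \<in> C" if "y \<in> C" "z \<in> c n y" for y z
    using c_Suc[OF sub[OF that(1)], of n] that(2) upper[OF that(1)] by auto
  have "\<forall>K\<in>c n ` C. \<exists>f. fills n K (E K) f \<and> (K = c n x \<longrightarrow> f = f0)"
  proof
    fix K assume K: "K \<in> c n ` C"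
    then obtain y where y: "y \<in> C" "K = c n y" by blast
    show "\<exists>f. fills n K (E K) f \<and> (K = c n x \<longrightarrow> f = f0)"
    proof (cases "K = c n x")
      case True
      then show ?thesis using f0 E0 by simp
    next
      case False
      have "fits n (c n y) (E (c n y))" using EQ y(1) by blast
      from IH[OF sub[OF y(1)] this] show ?thesis unfolding y(2) using False y(2) by simp
    qed
  qed
  from bchoice[OF this] obtain F where F':
    "\<forall>K\<in>c n ` C. fills n K (E K) (F K) \<and> (K = c n x \<longrightarrow> F K = f0)" by (elim exE)
  have F: "fills n (c n y) (E (c n y)) (F (c n y))" if "y \<in> C" for y using F' that by simp
  have F0: "F (c n x) = f0" using F' c_self[OF x, of "Suc n"] unfolding C_def by simp
  define f where "f z = F (c n z) z" for z
  have f_eq: "f z = F (c n y) z" if "y \<in> C" "z \<in> c n y" for y z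
    unfolding f_def c_eq[OF sub[OF that(1)] that(2)] ..
  have fE: "f y div B n \<in> E (c n y)" if "y \<in> C" for y
  proof -
    have "f y \<in> F (c n y) ` c n y" using mem[OF that] by (simp add: f_def)
    then show ?thesis using fillsD(1)[OF F[OF that]] by simp
  qed
  have fQ: "f y div B (Suc n) = Q (c n y)" if "y \<in> C" for y
  proof -
    have "E (c n y) \<subseteq> {m. m div ratio n = Q (c n y)}" using EQ that by simp
    from subsetD[OF this fE[OF that]] show ?thesis unfolding div_B_Suc by simp
  qed
  have "fills (Suc n) C D' f"
    unfolding fills_def
  proof (intro conjI allI ballI impI)
    show "f ` C = {y. y div B (Suc n) \<in> D'}"
    proof (intro equalityI subsetI)
      fix v assume "v \<in> f ` C"
      then obtain y where y: "y \<in> C" "v = f y" by blast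
      have "Q (c n y) \<in> D'" using Q y(1) by blast
      then show "v \<in> {y. y div B (Suc n) \<in> D'}" using fQ[OF y(1)] y(2) by simp
    next
      fix v assume "v \<in> {y. y div B (Suc n) \<in> D'}"
      then have "v div B n \<in> (\<Union>K\<in>c n ` C. E K)" unfolding cover by (simp add: div_B_Suc)
      then obtain y where y: "y \<in> C" "v div B n \<in> E (c n y)" by blast
      then have "v \<in> F (c n y) ` c n y" using fillsD(1)[OF F[OF y(1)]] by simp
      then obtain z where z: "z \<in> c n y" "v = F (c n y) z" by blast
      then have "v = f z" using f_eq[OF y(1)] by simp
      then show "v \<in> f ` C" using down[OF y(1) z(1)] by blast
    qed
  next
    fix i y z assume i: "i < Suc n" and y: "y \<in> C" and z: "z \<in> c i y"
    have zn: "z \<in> c n y" using c_mono[OF sub[OF y], of i n] i z by auto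
    show "f y div B (Suc i) = f z div B (Suc i)"
    proof (cases "i = n")
      case True
      have "c n z = c n y" by (rule c_eq[OF sub[OF y] zn])
      then show ?thesis using fQ[OF y] fQ[OF down[OF y zn]] True by simp
    next
      case False
      then have "i < n" using i by simp
      then have "F (c n y) y div B (Suc i) = F (c n y) z div B (Suc i)"
        by (rule fillsD(2)[OF F[OF y] _ mem[OF y] z])
      then show ?thesis using f_eq[OF y mem[OF y]] f_eq[OF y zn] by simp
    qed
  next
    fix i y z assume i: "i \<le> Suc n" and y: "y \<in> C" and z: "z \<in> C" and eq: "f y div B i = f z div B i"
    show "c i y = c i z"
    proof (cases "i = Suc n")
      case True
      then show ?thesis using upper[OF y] upper[OF z] by simp
    next
      case False
      then have i: "i \<le> n" using i by simp
      have "f y div B n = f z div B n" by (rule div_B_mono[OF i eq])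
      then have "E (c n y) \<inter> E (c n z) \<noteq> {}" using fE[OF y] fE[OF z] by auto
      moreover have "E (c n y) \<inter> E (c n z) = {}" if "c n y \<noteq> c n z"
        using disjoint_family_onD[OF disj _ _ that] y z by simp
      ultimately have K: "c n y = c n z" by blast
      have zn: "z \<in> c n y" unfolding K by (rule mem[OF z])
      have "F (c n y) y div B i = F (c n y) z div B i"
        using eq f_eq[OF y mem[OF y]] f_eq[OF y zn] by simp
      then show ?thesis by (rule fillsD(3)[OF F[OF y] i mem[OF y] zn])
    qed
  qed
  moreover have "\<forall>z\<in>c n x. f z = f0 z"
    using f_eq[of x] c_self[OF x, of "Suc n"] F0 unfolding C_def by simp
  ultimately show ?thesis unfolding C_def by (intro exI[of _ f] conjI)
qed

lemma fits_nonempty: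
  assumes "x \<in> X" "fits n (c n x) D"
  shows "D \<noteq> {}"
proof
  assume "D = {}"
  then have "(3/8 - tol n) * card (c n x) \<le> 0" using assms(2) unfolding fits_def by simp
  moreover have "0 < (3/8 - tol n) * card (c n x)"
    using tol_bounds(2)[of n] card_pos[OF assms(1), of n] by simp
  ultimately show False by linarith
qed

lemma fills_exists: "x \<in> X \<Longrightarrow> fits n (c n x) D \<Longrightarrow> \<exists>f. fills n (c n x) D f"
proof (induction n arbitrary: x D)
  case 0
  then show ?case by (rule fills_base)
next
  case (Suc n)
  obtain g where g: "g \<in> D" using fits_nonempty[OF Suc.prems] by blast
  obtain k where k: "k \<le> ratio n" "\<forall>D. finite D \<longrightarrow> card D = k \<longrightarrow> fits n (c n x) D"
    using fits_exists[OF Suc.prems(1), of n] by (elim exE conjE)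
  define D0 where "D0 = {g * ratio n..<g * ratio n + k}"
  have fits0: "fits n (c n x) D0" using k(2) by (simp add: D0_def)
  have sub0: "D0 \<subseteq> {m. m div ratio n = g}" unfolding D0_def subblocks using k(1) by auto
  obtain f0 where f0: "fills n (c n x) D0 f0" using Suc.IH[OF Suc.prems(1) fits0] by (elim exE)
  have "\<exists>f. fills (Suc n) (c (Suc n) x) D f \<and> (\<forall>z\<in>c n x. f z = f0 z)"
    by (rule fills_extend[OF Suc.prems g fits0 sub0 f0]) (rule Suc.IH)
  then show ?case by blast
qed

lemma B_gt:
  assumes "x \<in> X"
  shows "n < B (Suc n)"
proof -
  have "n < 2 ^ n" by (rule less_exp)
  also have "\<dots> \<le> 2 ^ (n + 6) * card (c n x)" using card_pos[OF assms, of n] by (simp add: power_add)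
  also have "\<dots> \<le> B (Suc n)" by (rule class_ll_block[OF assms])
  finally show ?thesis .
qed

text \<open>
  Prescribing the map on \<open>c n x0\<close> when filling \<open>c (Suc n) x0\<close> gives a coherent sequence of maps. Each
  of them fills an initial segment of the blocks, of length at least \<open>B n\<close>, so together they
  exhaust the natural numbers.
\<close>

lemma interleaved_surjection:
  assumes x0: "x0 \<in> X"
  shows "\<exists>f. f ` X = UNIV \<and>
    (\<forall>n. \<forall>x\<in>X. \<forall>y\<in>c n x. f x div B (Suc n) = f y div B (Suc n)) \<and>
    (\<forall>n. \<forall>x\<in>X. \<forall>y\<in>X. f x div B n = f y div B n \<longrightarrow> c n x = c n y)"
proof -
  define P where "P n f \<longleftrightarrow> (\<exists>k. 0 < k \<and> k \<le> ratio n \<and> fits n (c n x0) {..<k} \<and> fills n (c n x0) {..<k} f)" for n f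
  have "\<exists>F. \<forall>n. P n (F n) \<and> (\<forall>z\<in>c n x0. F (Suc n) z = F n z)"
  proof (rule dependent_nat_choice)
    show "\<exists>f. P 0 f"
    proof -
      obtain k where k: "0 < k" "k \<le> ratio 0" "\<forall>D. finite D \<longrightarrow> card D = k \<longrightarrow> fits 0 (c 0 x0) D"
        using fits_exists[OF x0, of 0] by (elim exE conjE)
      then have fits: "fits 0 (c 0 x0) {..<k}" by simp
      obtain f where "fills 0 (c 0 x0) {..<k} f" using fills_exists[OF x0 fits] by (elim exE)
      then have "P 0 f" unfolding P_def using k(1,2) fits by (intro exI conjI)
      then show ?thesis by blast
    qed
    fix f n assume "P n f"
    then obtain k where k: "0 < k" "k \<le> ratio n" "fits n (c n x0) {..<k}" "fills n (c n x0) {..<k} f"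
      unfolding P_def by (elim exE conjE)
    obtain l where l: "0 < l" "l \<le> ratio (Suc n)"
      "\<forall>D. finite D \<longrightarrow> card D = l \<longrightarrow> fits (Suc n) (c (Suc n) x0) D"
      using fits_exists[OF x0, of "Suc n"] by (elim exE conjE)
    then have fits': "fits (Suc n) (c (Suc n) x0) {..<l}" by simp
    \<comment> \<open>the old image stays inside the first block of the next length, since \<open>k \<le> ratio n\<close>\<close>
    have sub0: "{..<k} \<subseteq> {m. m div ratio n = 0}" using k(2) by auto
    have 0: "0 \<in> {..<l}" using l(1) by simp
    have "\<exists>f'. fills (Suc n) (c (Suc n) x0) {..<l} f' \<and> (\<forall>z\<in>c n x0. f' z = f z)"
      by (rule fills_extend[OF x0 fits' 0 k(3) sub0 k(4)]) (rule fills_exists)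
    then obtain f' where f': "fills (Suc n) (c (Suc n) x0) {..<l} f'" "\<forall>z\<in>c n x0. f' z = f z"
      by (elim exE conjE)
    have "P (Suc n) f'" unfolding P_def by (intro exI conjI) (rule l(1), rule l(2), rule fits', rule f'(1))
    then show "\<exists>f'. P (Suc n) f' \<and> (\<forall>z\<in>c n x0. f' z = f z)"
      using f'(2) by (intro exI[of _ f'] conjI)
  qed
  then obtain F where F': "\<forall>n. P n (F n) \<and> (\<forall>z\<in>c n x0. F (Suc n) z = F n z)" by (elim exE)
  have F: "P n (F n)" "z \<in> c n x0 \<Longrightarrow> F (Suc n) z = F n z" for n z
    using F'[rule_format, of n] by simp_all
  have F_le: "F m z = F n z" if "n \<le> m" "z \<in> c n x0" for m n z
    using that(1)
  proof (induction m rule: dec_induct)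
    case (step m)
    have "z \<in> c m x0" using c_mono[OF x0 step.hyps(1)] that(2) by blast
    then show ?case using F(2) step.IH by simp
  qed simp
  define f where "f z = F (LEAST n. z \<in> c n x0) z" for z
  have f_eq: "f z = F n z" if "z \<in> c n x0" for n z
    unfolding f_def
    by (rule F_le[symmetric]) (rule Least_le[of "\<lambda>n. z \<in> c n x0", OF that], rule LeastI[of "\<lambda>n. z \<in> c n x0", OF that])
  have common: "\<exists>N\<ge>n. x \<in> c N x0" if x: "x \<in> X" for x n
  proof -
    obtain m where m: "x \<in> c m x0" using c_exhaust[OF x0 x] by (elim exE)
    have "x \<in> c (max n m) x0" using c_mono[OF x0, of m "max n m"] m by auto
    then show ?thesis by (intro exI[of _ "max n m"]) simp
  qed
  have "f ` X = UNIV"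
  proof (intro equalityI subsetI)
    fix v :: nat
    obtain k where "0 < k" "fills (Suc v) (c (Suc v) x0) {..<k} (F (Suc v))"
      using F(1)[of "Suc v"] unfolding P_def by (elim exE conjE)
    moreover have "v div B (Suc v) = 0" using B_gt[OF x0, of v] by simp
    ultimately have "v \<in> F (Suc v) ` c (Suc v) x0" using fillsD(1) by simp
    then obtain z where z: "z \<in> c (Suc v) x0" "v = F (Suc v) z" by blast
    then have "v = f z" "z \<in> X" using f_eq c_sub[OF x0, of "Suc v"] by auto
    then show "v \<in> f ` X" by blast
  qed simp
  moreover have "f x div B (Suc n) = f y div B (Suc n)" if x: "x \<in> X" and y: "y \<in> c n x" for n x y
  proof -
    obtain N where N: "Suc n \<le> N" "x \<in> c N x0" using common[OF x, of "Suc n"] by (elim exE conjE)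
    have "y \<in> c N x" using c_mono[OF x, of n N] N(1) y by auto
    then have y': "y \<in> c N x0" using c_eq[OF x0 N(2)] by simp
    obtain k where "fills N (c N x0) {..<k} (F N)" using F(1)[of N] unfolding P_def by (elim exE conjE)
    then have "F N x div B (Suc n) = F N y div B (Suc n)"
      using fillsD(2)[of N _ _ _ n x y] N y by simp
    then show ?thesis using f_eq[OF N(2)] f_eq[OF y'] by simp
  qed
  moreover have "c n x = c n y" if x: "x \<in> X" and y: "y \<in> X" and eq: "f x div B n = f y div B n" for n x y
  proof -
    obtain M where M: "n \<le> M" "x \<in> c M x0" using common[OF x, of n] by (elim exE conjE)
    obtain N where N: "M \<le> N" "y \<in> c N x0" using common[OF y, of M] by (elim exE conjE)
    have x': "x \<in> c N x0" using c_mono[OF x0 N(1)] M(2) by blast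
    obtain k where k: "fills N (c N x0) {..<k} (F N)" using F(1)[of N] unfolding P_def by (elim exE conjE)
    have "F N x div B n = F N y div B n" using eq f_eq[OF x'] f_eq[OF N(2)] by simp
    moreover have "n \<le> N" using M(1) N(1) by simp
    ultimately show ?thesis using fillsD(3)[OF k _ x' N(2)] by simp
  qed
  ultimately show ?thesis by blast
qed

end

section \<open>Binary digits and the anti-Cantor set\<close>

definition digits :: "nat \<Rightarrow> nat \<Rightarrow> int" where
  "digits y i = of_bool (bit y i)"

lemma digits_in_anti_cantor: "digits y \<in> anti_cantor"
proof -
  have "digits y i = 0" if "y \<le> i" for i
  proof -
    have "y < 2 ^ i" using less_exp[of i] that by (rule le_less_trans[rotated])
    then show ?thesis by (simp add: digits_def bit_iff_odd)
  qed
  then show ?thesis by (auto simp: anti_cantor_def digits_def)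
qed

lemma digits_surj:
  assumes "z \<in> anti_cantor"
  shows "\<exists>y. digits y = z"
proof -
  obtain m where m: "\<forall>i\<ge>m. z i = 0" and z: "\<And>i. z i \<in> {0, 1}"
    using assms by (auto simp: anti_cantor_def)
  have "digits (horner_sum of_bool 2 (map (\<lambda>i. z i = 1) [0..<m])) i = z i" for i
    using m z[of i] by (cases "i < m") (auto simp: digits_def bit_horner_sum_bit_iff)
  then show ?thesis by blast
qed

lemma digits_dist_le:
  assumes "y div 2 ^ k = z div 2 ^ k"
  shows "anti_cantor_dist (digits y) (digits z) \<le> 2 ^ k"
proof -
  obtain n where n: "anti_cantor_dist (digits y) (digits z) = 2 ^ n * real_of_int \<bar>digits y n - digits z n\<bar>"
    using anti_cantor_dist_attained[OF digits_in_anti_cantor digits_in_anti_cantor] by blast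
  show ?thesis
  proof (cases "n < k")
    case True
    have "2 ^ n * real_of_int \<bar>digits y n - digits z n\<bar> \<le> 2 ^ n * 1"
      by (rule mult_left_mono) (auto simp: digits_def)
    also have "\<dots> \<le> 2 ^ k" using True by simp
    finally show ?thesis using n by simp
  next
    case False
    then have "bit v n = bit (v div 2 ^ k) (n - k)" for v :: nat
      by (simp add: bit_drop_bit_eq flip: drop_bit_eq_div)
    then show ?thesis using assms n by (simp add: digits_def)
  qed
qed

lemma digits_dist_less:
  assumes "anti_cantor_dist (digits y) (digits z) < 2 ^ k"
  shows "y div 2 ^ k = z div 2 ^ k"
proof -
  have "drop_bit k y = drop_bit k z"
  proof (rule bit_eqI)
    fix i
    have "bit y (k + i) = bit z (k + i)"
    proof (rule ccontr)
      assume "bit y (k + i) \<noteq> bit z (k + i)"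
      then have "2 ^ (k + i) \<le> anti_cantor_dist (digits y) (digits z)"
        using anti_cantor_dist_ge[OF digits_in_anti_cantor digits_in_anti_cantor, of "k + i" y z]
        by (cases "bit z (k + i)") (simp_all add: digits_def)
      moreover have "(2::real) ^ k \<le> 2 ^ (k + i)" by simp
      ultimately show False using assms by linarith
    qed
    then show "bit (drop_bit k y) i = bit (drop_bit k z) i" by (simp add: bit_drop_bit_eq)
  qed
  then show ?thesis by (simp add: drop_bit_eq_div)
qed

text \<open>
  The hypothesis \<open>proper\<close> says that preimages of bounded sets are uniformly bounded. It makes
  every right inverse of \<open>F\<close> bornologous, and applied to the fibres it bounds the displacement of the
  right inverse after \<open>F\<close>.
\<close>

lemma coarsely_equivalent_by_surjection:
  assumes "F ` X = Y" "bornologous X dX Y dY F"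
    and proper: "\<And>\<epsilon>. \<exists>R. \<forall>x\<in>X. \<forall>x'\<in>X. dY (F x) (F x') \<le> \<epsilon> \<longrightarrow> dX x x' \<le> R"
    and refl: "\<And>y. y \<in> Y \<Longrightarrow> dY y y = 0"
  shows "coarsely_equivalent X dX Y dY"
proof -
  define g where "g = inv_into X F"
  have g: "g y \<in> X" "F (g y) = y" if "y \<in> Y" for y
    using that assms(1) unfolding g_def by (auto simp: inv_into_into f_inv_into_f)
  have FY: "F x \<in> Y" if "x \<in> X" for x using assms(1) that by blast
  have "bornologous Y dY X dX g"
    unfolding bornologous_def
  proof (intro conjI allI)
    show "g \<in> Y \<rightarrow> X" using g(1) by blast
    fix \<epsilon> :: real
    obtain R where "\<forall>x\<in>X. \<forall>x'\<in>X. dY (F x) (F x') \<le> \<epsilon> \<longrightarrow> dX x x' \<le> R" using proper by blast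
    then show "\<exists>\<delta>. \<forall>x\<in>Y. \<forall>x'\<in>Y. dY x x' \<le> \<epsilon> \<longrightarrow> dX (g x) (g x') \<le> \<delta>"
      by (intro exI[of _ R]) (use g in auto)
  qed
  moreover have "bdd_above ((\<lambda>x. dX (g (F x)) x) ` X)"
  proof -
    obtain R where R: "\<forall>x\<in>X. \<forall>x'\<in>X. dY (F x) (F x') \<le> 0 \<longrightarrow> dX x x' \<le> R" using proper by blast
    have "dX (g (F x)) x \<le> R" if "x \<in> X" for x
      using R g[OF FY[OF that]] refl[OF FY[OF that]] that by auto
    then show ?thesis by (rule bdd_aboveI2)
  qed
  moreover have "bdd_above ((\<lambda>y. dY (F (g y)) y) ` Y)"
    by (rule bdd_aboveI2[of _ _ 0]) (simp add: g refl)
  ultimately show ?thesis using assms(2) unfolding coarsely_equivalent_def by blast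
qed

section \<open>Consequences of the finite entropy product\<close>

text \<open>
  Every factor that is at least \<open>2\<close> doubles the partial products, which never decrease.
\<close>

lemma finitely_many_large_factors:
  fixes f :: "nat \<Rightarrow> ennreal"
  assumes ge: "\<And>n. 1 \<le> f n" and fin: "prodinf f < \<infinity>"
  shows "finite {n. 2 \<le> f n}"
proof (rule ccontr)
  define p where "p n = (\<Prod>i\<le>n. f i)" for n
  have p_Suc: "p (Suc n) = p n * f (Suc n)" for n by (simp add: p_def)
  have inc: "incseq p"
  proof (rule incseq_SucI)
    show "p n \<le> p (Suc n)" for n
      using mult_left_mono[OF ge[of "Suc n"], of "p n"] by (simp add: p_Suc)
  qed
  assume "\<not> finite {n. 2 \<le> f n}"
  then have inf: "\<exists>m>n. 2 \<le> f m" for n by (simp add: infinite_nat_iff_unbounded)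
  have "\<exists>n. 2 ^ k \<le> p n" for k
  proof (induction k)
    case 0
    then show ?case using ge[of 0] by (auto simp: p_def intro!: exI[of _ 0])
  next
    case (Suc k)
    then obtain n where n: "2 ^ k \<le> p n" by blast
    obtain m where m: "n < m" "2 \<le> f m" using inf by blast
    then obtain l where l: "m = Suc l" by (cases m) auto
    have "p n \<le> p l" using incseqD[OF inc, of n l] m l by simp
    then have "2 ^ k \<le> p l" using n by (rule order_trans[rotated])
    then have "2 ^ k * 2 \<le> p l * f m" using m(2) by (rule mult_mono) auto
    then show ?case using l p_Suc by (intro exI[of _ m]) (simp add: mult.commute)
  qed
  note large = this
  have le: "p n \<le> prodinf f" for n
    unfolding prodinf_ennreal_eq_SUP[OF ge] p_def by (rule SUP_upper) simp
  have big: "2 ^ k \<le> prodinf f" for k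
  proof -
    obtain n where "2 ^ k \<le> p n" using large[of k] by (elim exE)
    then show ?thesis using le by (rule order_trans)
  qed
  obtain c where c: "0 \<le> c" "prodinf f = ennreal c" using fin by (cases "prodinf f") auto
  obtain k where k: "c < 2 ^ k" using real_arch_pow[of 2 c] by auto
  have "ennreal (2 ^ k) \<le> ennreal c" using big[of k] c(2) by (simp add: ennreal_power[symmetric])
  then show False using k c(1) by (simp add: ennreal_le_iff)
qed

context Metric_space
begin

text \<open>
  The infimum over nets is attained, as \<open>enat\<close> is well-ordered.
\<close>

lemma Ent_le_iff:
  "Ent \<epsilon> S \<le> enat k \<longleftrightarrow> (\<exists>N. eps_net \<epsilon> S N \<and> finite N \<and> card N \<le> k)"
proof
  assume le: "Ent \<epsilon> S \<le> enat k"
  have "\<exists>N. eps_net \<epsilon> S N \<and> ecard N \<le> enat k"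
  proof (rule ccontr)
    assume "\<not> (\<exists>N. eps_net \<epsilon> S N \<and> ecard N \<le> enat k)"
    then have "enat (Suc k) \<le> ecard N" if "eps_net \<epsilon> S N" for N
      using that by (auto simp: Suc_ile_eq not_le)
    then have "enat (Suc k) \<le> Ent \<epsilon> S" unfolding Ent_def by (intro INF_greatest) simp
    then have "enat (Suc k) \<le> enat k" using le by (rule order_trans)
    then show False by simp
  qed
  then show "\<exists>N. eps_net \<epsilon> S N \<and> finite N \<and> card N \<le> k"
    by (auto simp: ecard_def split: if_splits)
next
  assume "\<exists>N. eps_net \<epsilon> S N \<and> finite N \<and> card N \<le> k"
  then obtain N where N: "eps_net \<epsilon> S N" "finite N" "card N \<le> k" by blast
  have "Ent \<epsilon> S \<le> ecard N" unfolding Ent_def by (rule INF_lower) (simp add: N)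
  also have "\<dots> \<le> enat k" using N by (simp add: ecard_def)
  finally show "Ent \<epsilon> S \<le> enat k" .
qed

lemma Ent_ge_1:
  assumes "S \<noteq> {}"
  shows "1 \<le> Ent \<epsilon> S"
  unfolding Ent_def
proof (rule INF_greatest)
  fix N assume "N \<in> {N. eps_net \<epsilon> S N}"
  then have "N \<noteq> {}" using assms by (auto simp: eps_net_def)
  then show "1 \<le> ecard N"
    by (simp add: ecard_def one_enat_def Suc_le_eq card_gt_0_iff)
qed

lemma Ent_finite_of_compactin:
  assumes "0 < \<epsilon>" "compactin mtopology S"
  shows "Ent \<epsilon> S < \<infinity>"
proof -
  have "mtotally_bounded S" using assms(2) by (rule compactin_imp_mtotally_bounded)
  then obtain K where K: "finite K" "K \<subseteq> S" "S \<subseteq> (\<Union>x\<in>K. mball x \<epsilon>)"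
    using assms(1) unfolding mtotally_bounded_def by (elim allE[of _ \<epsilon>] impE exE conjE)
  have "eps_net \<epsilon> S K"
    unfolding eps_net_def
  proof (intro conjI ballI)
    fix x assume "x \<in> S"
    then obtain y where "y \<in> K" "x \<in> mball y \<epsilon>" using K(3) by blast
    then show "\<exists>y\<in>K. d x y < \<epsilon>" by (intro bexI[of _ y]) (simp_all add: commute)
  qed (rule K(2))
  then have "Ent \<epsilon> S \<le> enat (card K)"
    unfolding Ent_le_iff using K(1) by (intro exI[of _ K] conjI order_refl)
  then show ?thesis by (rule le_less_trans) simp
qed

end

context Proper_metric_space
begin

lemma nonempty: "M \<noteq> {}"
proof
  assume empty: "M = {}"
  have "mbounded S" if "S = {}" for S using that by simp
  from this[OF empty] unbounded show False by (rule notE[rotated])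
qed

lemma ent_bounds:
  assumes "0 < \<epsilon>" "0 \<le> \<delta>"
  shows "1 \<le> ent_min \<epsilon> \<delta>" "ent_min \<epsilon> \<delta> < \<infinity>" "ent_min \<epsilon> \<delta> \<le> Ent_sup \<epsilon> \<delta>"
proof -
  have "1 \<le> Ent \<epsilon> (mcball x \<delta>)" if "x \<in> M" for x
  proof (rule Ent_ge_1)
    have "x \<in> mcball x \<delta>" using that assms(2) by simp
    then show "mcball x \<delta> \<noteq> {}" by blast
  qed
  then show "1 \<le> ent_min \<epsilon> \<delta>" unfolding ent_min_def by (intro INF_greatest)
  obtain x where x: "x \<in> M" using nonempty by blast
  have "ent_min \<epsilon> \<delta> \<le> Ent \<epsilon> (mcball x \<delta>)" unfolding ent_min_def by (rule INF_lower[OF x])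
  also have "\<dots> < \<infinity>" by (rule Ent_finite_of_compactin[OF assms(1) compactin_mcball[OF x]])
  finally show "ent_min \<epsilon> \<delta> < \<infinity>" .
  have "ent_min \<epsilon> \<delta> \<le> Ent \<epsilon> (mcball x \<delta>)" unfolding ent_min_def by (rule INF_lower[OF x])
  also have "\<dots> \<le> Ent_sup \<epsilon> \<delta>" unfolding Ent_sup_def by (rule SUP_upper[OF x])
  finally show "ent_min \<epsilon> \<delta> \<le> Ent_sup \<epsilon> \<delta>" .
qed

text \<open>
  Properness makes every denominator a positive integer, so the factors are at least \<open>1\<close> and the
  partial products converge to the infinite product. A finite product bounds each factor, hence each
  numerator. For large \<open>n\<close> the factor is below \<open>2\<close>; when its denominator is \<open>1\<close>, its numerator is an
  integer below \<open>2\<close>.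
\<close>

lemma entropy_of_finite_product:
  fixes r :: "nat \<Rightarrow> real"
  assumes r: "\<And>n. 0 < r n"
    and fin: "(\<Prod>n. ennreal_of_enat (Ent_sup (r n) (r (Suc n))) /
                 ennreal_of_enat (ent_min (r n) (r (Suc n)))) < \<infinity>"
  shows "Ent_sup (r n) (r (Suc n)) < \<infinity>"
    and "\<exists>n0. \<forall>n\<ge>n0. ent_min (r n) (r (Suc n)) \<le> 1 \<longrightarrow> Ent_sup (r n) (r (Suc n)) \<le> 1"
proof -
  define u where "u n = Ent_sup (r n) (r (Suc n))" for n
  define l where "l n = ent_min (r n) (r (Suc n))" for n
  define f where "f n = ennreal_of_enat (u n) / ennreal_of_enat (l n)" for n
  have l: "1 \<le> l n" "l n < \<infinity>" "l n \<le> u n" for n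
    unfolding l_def u_def by (rule ent_bounds[OF r less_imp_le[OF r]])+
  have l0: "ennreal_of_enat (l n) \<noteq> 0" "ennreal_of_enat (l n) \<noteq> \<infinity>" for n
    using l(1,2)[of n] by (cases "l n"; auto simp: one_enat_def)+
  have ge: "1 \<le> f n" for n
  proof -
    have "1 = ennreal_of_enat (l n) / ennreal_of_enat (l n)" using l0[of n] by (simp add: ennreal_divide_self less_top)
    also have "\<dots> \<le> f n" unfolding f_def
      by (rule divide_right_mono_ennreal) (simp add: ennreal_of_enat_le_iff l(3))
    finally show ?thesis .
  qed
  have prod: "prodinf f < \<infinity>" using fin unfolding f_def u_def l_def .
  have "f n \<le> prodinf f" for n
  proof -
    have "f n \<le> (\<Prod>i\<le>n. f i)"
    proof (cases n)
      case (Suc m)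
      have "1 \<le> (\<Prod>i\<le>m. f i)" using ge by (rule prod_ge_1)
      then have "1 * f n \<le> (\<Prod>i\<le>m. f i) * f n" by (rule mult_right_mono) simp
      then show ?thesis using Suc by simp
    qed simp
    also have "\<dots> \<le> prodinf f" unfolding prodinf_ennreal_eq_SUP[OF ge] by (rule SUP_upper) simp
    finally show ?thesis .
  qed
  then have "f n < \<infinity>" using prod by (rule le_less_trans)
  then have "ennreal_of_enat (u n) \<noteq> \<infinity>" using l0[of n] unfolding f_def by (auto simp: ennreal_top_divide)
  then show "Ent_sup (r n) (r (Suc n)) < \<infinity>" unfolding u_def[symmetric] by (cases "u n") auto
  obtain n0 where n0: "\<forall>n. 2 \<le> f n \<longrightarrow> n < n0"
    using finitely_many_large_factors[OF ge prod] by (auto simp: finite_nat_iff_bounded)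
  have "u n \<le> 1" if "n0 \<le> n" "l n \<le> 1" for n
  proof -
    have "l n = 1" using l(1)[of n] that(2) by (rule antisym[rotated])
    then have "f n = ennreal_of_enat (u n)" unfolding f_def by (simp add: one_enat_def divide_ennreal_def)
    moreover have "\<not> 2 \<le> f n" using n0 that(1) by auto
    ultimately have "ennreal_of_enat (u n) < 2" by (simp only: not_le)
    then show ?thesis
      by (cases "u n") (auto simp: one_enat_def ennreal_of_nat_eq_real_of_nat ennreal_less_iff simp flip: ennreal_numeral)
  qed
  then show "\<exists>n0. \<forall>n\<ge>n0. ent_min (r n) (r (Suc n)) \<le> 1 \<longrightarrow> Ent_sup (r n) (r (Suc n)) \<le> 1"
    unfolding u_def l_def by blast
qed

end

section \<open>Representatives and volumes in ultrametric spaces\<close>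

context Ultrametric_space
begin

lemma mball_eq:
  assumes "x \<in> M" "y \<in> M" "d x y < r"
  shows "mball x r = mball y r"
proof -
  have "d y z < r" if "z \<in> M" "d x z < r" for z
    using ultrametric[OF assms(2) that(1) assms(1)] that(2) assms(3) by (simp add: commute)
  moreover have "d x z < r" if "z \<in> M" "d y z < r" for z
    using ultrametric[OF assms(1) that(1) assms(2)] that(2) assms(3) by simp
  ultimately show ?thesis using assms by auto
qed

lemma mcball_eq:
  assumes "x \<in> M" "y \<in> M" "d x y \<le> r"
  shows "mcball x r = mcball y r"
proof -
  have "d y z \<le> r" if "z \<in> M" "d x z \<le> r" for z
    using ultrametric[OF assms(2) that(1) assms(1)] that(2) assms(3) by (simp add: commute)
  moreover have "d x z \<le> r" if "z \<in> M" "d y z \<le> r" for z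
    using ultrametric[OF assms(1) that(1) assms(2)] that(2) assms(3) by simp
  ultimately show ?thesis using assms by auto
qed

text \<open>
  A canonical choice of one point per open ball: the definition depends on \<open>x\<close> only through
  its ball, so points of the same ball have the same representative.
\<close>

definition rep :: "real \<Rightarrow> 'a \<Rightarrow> 'a" where
  "rep s x = (SOME y. y \<in> mball x s)"

context
  fixes s :: real
  assumes s: "0 < s"
begin

lemma rep:
  assumes "x \<in> M"
  shows "rep s x \<in> M" "d x (rep s x) < s"
proof -
  have "x \<in> mball x s" using assms s by simp
  then have "rep s x \<in> mball x s" unfolding rep_def by (rule someI)
  then show "rep s x \<in> M" "d x (rep s x) < s" by simp_all
qed

lemma rep_eq: "x \<in> M \<Longrightarrow> y \<in> M \<Longrightarrow> d x y < s \<Longrightarrow> rep s x = rep s y"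
  unfolding rep_def by (simp only: mball_eq)

lemma dist_rep_le:
  assumes "x \<in> M" "y \<in> M" "s \<le> t" "d x y \<le> t"
  shows "d (rep s x) (rep s y) \<le> t"
  using ultrametric[OF rep(1)[OF assms(1)] rep(1)[OF assms(2)] assms(1)]
    ultrametric[OF assms(1) rep(1)[OF assms(2)] assms(2)] rep(2)[OF assms(1)] rep(2)[OF assms(2)] assms(3,4)
  by (simp add: commute)

lemma dist_le_rep:
  assumes "x \<in> M" "y \<in> M" "s \<le> t" "d (rep s x) (rep s y) \<le> t"
  shows "d x y \<le> t"
  using ultrametric[OF assms(1) assms(2) rep(1)[OF assms(1)]]
    ultrametric[OF rep(1)[OF assms(1)] assms(2) rep(1)[OF assms(2)]] rep(2)[OF assms(1)] rep(2)[OF assms(2)] assms(3,4)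
  by (simp add: commute)

lemma reps_in_mball:
  assumes "x \<in> M"
  shows "rep s ` M \<inter> mball x s \<subseteq> {rep s x}"
proof
  fix u assume "u \<in> rep s ` M \<inter> mball x s"
  then obtain y where y: "y \<in> M" "u = rep s y" "d x u < s" by auto
  have "d x y \<le> max (d x u) (d u y)"
    using ultrametric[OF assms y(1) rep(1)[OF y(1)]] y(2) by simp
  then have "d x y < s" using rep(2)[OF y(1)] y(2,3) by (simp add: commute)
  then show "u \<in> {rep s x}" using rep_eq[OF assms y(1)] y(2) by simp
qed

end

text \<open>
  A closed \<open>\<delta>\<close>-ball is covered by boundedly many open \<open>\<epsilon>\<close>-balls, so a uniform bound on the number
  of points of \<open>N\<close> passes from the scale \<open>\<epsilon>\<close> to the scale \<open>\<delta>\<close>.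
\<close>

lemma card_Int_mcball_bounded:
  assumes Ent: "Ent_sup \<epsilon> \<delta> < \<infinity>"
    and q: "\<forall>x\<in>M. finite (N \<inter> mball x \<epsilon>) \<and> card (N \<inter> mball x \<epsilon>) \<le> q"
  shows "\<exists>q'. \<forall>x\<in>M. finite (N \<inter> mcball x \<delta>) \<and> card (N \<inter> mcball x \<delta>) \<le> q'"
proof -
  obtain k where k: "Ent_sup \<epsilon> \<delta> = enat k" using Ent by auto
  have "finite (N \<inter> mcball x \<delta>) \<and> card (N \<inter> mcball x \<delta>) \<le> k * q" if x: "x \<in> M" for x
  proof -
    have "Ent \<epsilon> (mcball x \<delta>) \<le> Ent_sup \<epsilon> \<delta>" unfolding Ent_sup_def by (rule SUP_upper[OF x])
    then have "\<exists>K. eps_net \<epsilon> (mcball x \<delta>) K \<and> finite K \<and> card K \<le> k"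
      unfolding k Ent_le_iff .
    then obtain K where K: "eps_net \<epsilon> (mcball x \<delta>) K" "finite K" "card K \<le> k" by (elim exE conjE)
    have KM: "y \<in> M" if "y \<in> K" for y using K(1) that unfolding eps_net_def by auto
    have cover: "N \<inter> mcball x \<delta> \<subseteq> (\<Union>y\<in>K. N \<inter> mball y \<epsilon>)"
    proof
      fix z assume z: "z \<in> N \<inter> mcball x \<delta>"
      then obtain y where "y \<in> K" "d z y < \<epsilon>" using K(1) unfolding eps_net_def by blast
      then show "z \<in> (\<Union>y\<in>K. N \<inter> mball y \<epsilon>)" using z KM[of y] by (auto simp: commute)
    qed
    have fin: "finite (\<Union>y\<in>K. N \<inter> mball y \<epsilon>)" using K(2) q KM by blast
    have "card (N \<inter> mcball x \<delta>) \<le> card (\<Union>y\<in>K. N \<inter> mball y \<epsilon>)" by (rule card_mono[OF fin cover])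
    also have "\<dots> \<le> (\<Sum>y\<in>K. card (N \<inter> mball y \<epsilon>))" by (rule card_UN_le[OF K(2)])
    also have "\<dots> \<le> card K * q" using sum_bounded_above[of K "\<lambda>y. card (N \<inter> mball y \<epsilon>)" q] q KM by simp
    also have "\<dots> \<le> k * q" using K(3) by simp
    finally show ?thesis using finite_subset[OF cover fin] by blast
  qed
  then show ?thesis by blast
qed

text \<open>
  Otherwise the centre alone would be an \<open>\<epsilon>\<close>-net of its \<open>\<delta>\<close>-ball.
\<close>

lemma ball_not_small:
  assumes "2 \<le> ent_min \<epsilon> \<delta>" "x \<in> M" "0 \<le> \<delta>"
  shows "\<exists>y\<in>mcball x \<delta>. \<epsilon> \<le> d x y"
proof (rule ccontr)
  assume "\<not> (\<exists>y\<in>mcball x \<delta>. \<epsilon> \<le> d x y)"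
  then have *: "d x y < \<epsilon>" if "y \<in> mcball x \<delta>" for y using that by (meson not_le)
  have "eps_net \<epsilon> (mcball x \<delta>) {x}"
    unfolding eps_net_def using * assms(2,3) by (auto simp: commute)
  then have "Ent \<epsilon> (mcball x \<delta>) \<le> enat 1" unfolding Ent_le_iff by (intro exI[of _ "{x}"]) simp
  moreover have "ent_min \<epsilon> \<delta> \<le> Ent \<epsilon> (mcball x \<delta>)" unfolding ent_min_def by (rule INF_lower[OF assms(2)])
  ultimately have "2 \<le> enat 1" using assms(1) by (meson order_trans)
  then show False by (simp add: numeral_eq_enat)
qed

text \<open>
  The single point of a net is within \<open>\<epsilon>\<close> of all points of the ball, the centre included, so by the
  ultrametric inequality all points are within \<open>\<epsilon>\<close> of the centre.
\<close>

lemma ball_collapses: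
  assumes "Ent_sup \<epsilon> \<delta> \<le> 1" "x \<in> M" "0 \<le> \<delta>"
  shows "mcball x \<delta> \<subseteq> mcball x \<epsilon>"
proof
  fix z assume z: "z \<in> mcball x \<delta>"
  have "Ent \<epsilon> (mcball x \<delta>) \<le> Ent_sup \<epsilon> \<delta>" unfolding Ent_sup_def by (rule SUP_upper[OF assms(2)])
  then have "Ent \<epsilon> (mcball x \<delta>) \<le> enat 1" using assms(1) unfolding one_enat_def by (rule order_trans)
  then have "\<exists>K. eps_net \<epsilon> (mcball x \<delta>) K \<and> finite K \<and> card K \<le> 1" unfolding Ent_le_iff .
  then obtain K where K: "eps_net \<epsilon> (mcball x \<delta>) K" "finite K" "card K \<le> 1" by (elim exE conjE)
  have x: "x \<in> mcball x \<delta>" using assms by simp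
  obtain y where y: "y \<in> K" "d x y < \<epsilon>" using K(1) x unfolding eps_net_def by blast
  obtain y' where y': "y' \<in> K" "d z y' < \<epsilon>" using K(1) z unfolding eps_net_def by blast
  have "y' = y" using card_le_Suc0_iff_eq[OF K(2)] K(3) y(1) y'(1) by simp
  moreover have "y \<in> M" using y(1) K(1) unfolding eps_net_def by auto
  moreover have "z \<in> M" using z by simp
  ultimately have "d x z < \<epsilon>"
    using ultrametric[of x z y] y(2) y'(2) assms(2) by (simp add: commute)
  then show "z \<in> mcball x \<epsilon>" using assms(2) z by simp
qed

end

section \<open>From scales with tame entropy to the anti-Cantor set\<close>

locale proper_ultrametric_space = Proper_metric_space + Ultrametric_space

locale tame_scales = proper_ultrametric_space +
  fixes r :: "nat \<Rightarrow> real"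
  assumes r_pos: "0 < r n"
    and r_mono: "strict_mono r"
    and r_unbounded: "\<not> bdd_above (range r)"
    and Ent_finite: "Ent_sup (r n) (r (Suc n)) < \<infinity>"
    and Ent_collapse: "\<exists>n0. \<forall>n\<ge>n0. ent_min (r n) (r (Suc n)) \<le> 1 \<longrightarrow> Ent_sup (r n) (r (Suc n)) \<le> 1"
begin

definition N :: "'a set" where "N = rep (r 0) ` M"

definition vol :: "nat \<Rightarrow> 'a \<Rightarrow> nat" where "vol n x = card (N \<inter> mcball x (r n))"

lemma r_le: "i \<le> j \<Longrightarrow> r i \<le> r j"
  using r_mono by (simp add: strict_mono_less_eq)

lemma r_reaches: "\<exists>i\<ge>n. t \<le> r i"
proof -
  have "\<exists>k. t < r k"
  proof (rule ccontr)
    assume "\<not> (\<exists>k. t < r k)"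
    then have "bdd_above (range r)" by (intro bdd_aboveI2[of _ _ t]) (simp add: not_less)
    then show False using r_unbounded by simp
  qed
  then obtain k where k: "t < r k" by (elim exE)
  have "r k \<le> r (max n k)" by (rule r_le) simp
  then show ?thesis using k by (intro exI[of _ "max n k"]) simp
qed

lemma N_sub: "N \<subseteq> M"
  unfolding N_def using rep(1)[OF r_pos] by blast

text \<open>
  Induction along the scales. It starts from open balls of radius \<open>r 0\<close>, which contain at most one
  point of \<open>N\<close>, and alternates between closed balls and the smaller open balls of the same radius.
\<close>

lemma vol_bounded: "\<exists>q. \<forall>x\<in>M. finite (N \<inter> mcball x (r n)) \<and> vol n x \<le> q"
proof -
  have step: "\<exists>q'. \<forall>x\<in>M. finite (N \<inter> mcball x (r (Suc n))) \<and> card (N \<inter> mcball x (r (Suc n))) \<le> q'"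
    if "\<exists>q. \<forall>x\<in>M. finite (N \<inter> mball x (r n)) \<and> card (N \<inter> mball x (r n)) \<le> q" for n
    using that by (elim exE) (rule card_Int_mcball_bounded[OF Ent_finite])
  have weaken: "\<exists>q. \<forall>x\<in>M. finite (N \<inter> S x) \<and> card (N \<inter> S x) \<le> q"
    if bound: "\<exists>q. \<forall>x\<in>M. finite (N \<inter> T x) \<and> card (N \<inter> T x) \<le> q" and "\<And>x. S x \<subseteq> T x"
    for S T :: "'a \<Rightarrow> 'a set"
  proof -
    obtain q where q: "\<forall>x\<in>M. finite (N \<inter> T x) \<and> card (N \<inter> T x) \<le> q" using bound by (elim exE)
    have "finite (N \<inter> S x) \<and> card (N \<inter> S x) \<le> q" if x: "x \<in> M" for x
    proof -
      have sub: "N \<inter> S x \<subseteq> N \<inter> T x" using \<open>S x \<subseteq> T x\<close> by blast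
      have fin: "finite (N \<inter> T x)" using q x by simp
      show ?thesis using finite_subset[OF sub fin] card_mono[OF fin sub] q x by auto
    qed
    then show ?thesis by (intro exI[of _ q]) simp
  qed
  have open_bounded: "\<exists>q. \<forall>x\<in>M. finite (N \<inter> mball x (r n)) \<and> card (N \<inter> mball x (r n)) \<le> q" for n
  proof (induction n)
    case 0
    have "finite (N \<inter> mball x (r 0)) \<and> card (N \<inter> mball x (r 0)) \<le> 1" if "x \<in> M" for x
    proof -
      have sub: "N \<inter> mball x (r 0) \<subseteq> {rep (r 0) x}" unfolding N_def by (rule reps_in_mball[OF r_pos that])
      show ?thesis using finite_subset[OF sub] card_mono[OF _ sub] by simp
    qed
    then show ?case by (intro exI[of _ 1]) simp
  next
    case (Suc n)
    show ?case by (rule weaken[OF step[OF Suc.IH]]) auto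
  qed
  have "\<exists>q. \<forall>x\<in>M. finite (N \<inter> mcball x (r n)) \<and> card (N \<inter> mcball x (r n)) \<le> q"
    by (rule weaken[OF step[OF open_bounded[of n]]]) (use r_le[of n "Suc n"] in auto)
  then show ?thesis unfolding vol_def .
qed

lemma finite_N_ball: "x \<in> M \<Longrightarrow> finite (N \<inter> mcball x (r n))"
  using vol_bounded[of n] by blast

lemma vol_mono: "x \<in> M \<Longrightarrow> i \<le> j \<Longrightarrow> vol i x \<le> vol j x"
  unfolding vol_def by (rule card_mono[OF finite_N_ball]) (use r_le[of i j] in auto)

text \<open>
  Otherwise, from some scale on, both entropies equal \<open>1\<close> at every step; then all larger balls
  collapse to one ball of fixed radius, and the space would be bounded.
\<close>

lemma ent_ge_2: "\<exists>i\<ge>n. 2 \<le> ent_min (r i) (r (Suc i))"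
proof (rule ccontr)
  assume *: "\<not> (\<exists>i\<ge>n. 2 \<le> ent_min (r i) (r (Suc i)))"
  obtain n0 where n0: "\<forall>n\<ge>n0. ent_min (r n) (r (Suc n)) \<le> 1 \<longrightarrow> Ent_sup (r n) (r (Suc n)) \<le> 1"
    using Ent_collapse by (elim exE)
  define p where "p = max n n0"
  have small: "Ent_sup (r i) (r (Suc i)) \<le> 1" if "p \<le> i" for i
  proof -
    have "\<not> 2 \<le> ent_min (r i) (r (Suc i))" using * that by (auto simp: p_def)
    then have "ent_min (r i) (r (Suc i)) \<le> 1"
      by (cases "ent_min (r i) (r (Suc i))") (auto simp: numeral_eq_enat one_enat_def)
    then show ?thesis using n0 that by (simp add: p_def)
  qed
  obtain x where x: "x \<in> M" using nonempty by blast
  have sub: "mcball x (r i) \<subseteq> mcball x (r p)" if "p \<le> i" for i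
    using that
  proof (induction i rule: dec_induct)
    case (step i)
    have "mcball x (r (Suc i)) \<subseteq> mcball x (r i)"
      by (rule ball_collapses[OF small[OF step.hyps(1)] x less_imp_le[OF r_pos]])
    then show ?case using step.IH by (rule subset_trans)
  qed simp
  have "M \<subseteq> mcball x (r p)"
  proof
    fix y assume y: "y \<in> M"
    obtain i where i: "p \<le> i" "d x y \<le> r i" using r_reaches[of p "d x y"] by (elim exE conjE)
    then have "y \<in> mcball x (r i)" using x y by simp
    then show "y \<in> mcball x (r p)" by (rule subsetD[OF sub[OF i(1)]])
  qed
  then have "mbounded M" unfolding mbounded_def by (intro exI)
  then show False using unbounded by (rule notE[rotated])
qed

text \<open>
  Each scale \<open>i\<close> provided by \<open>ent_ge_2\<close> adds at least one point to the volume: a point at distance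
  between \<open>r i\<close> and \<open>r (Suc i)\<close> from the centre has its representative in the same range, hence outside
  every ball of smaller radius around that centre.
\<close>

lemma vol_unbounded: "\<exists>n. \<forall>m\<ge>n. \<forall>x\<in>M. j \<le> vol m x"
proof (induction j)
  case 0
  show ?case by simp
next
  case (Suc j)
  then obtain n where n: "\<forall>m\<ge>n. \<forall>x\<in>M. j \<le> vol m x" by (elim exE)
  obtain i where i: "Suc n \<le> i" "2 \<le> ent_min (r i) (r (Suc i))" using ent_ge_2[of "Suc n"] by (elim exE conjE)
  have "Suc j \<le> vol (Suc i) x" if x: "x \<in> M" for x
  proof -
    obtain y where y: "y \<in> mcball x (r (Suc i))" "r i \<le> d x y"
      using ball_not_small[OF i(2) x less_imp_le[OF r_pos]] by (elim bexE)
    have yM: "y \<in> M" using y(1) by simp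
    define u where "u = rep (r 0) y"
    have u: "u \<in> M" "d y u < r 0" "u \<in> N" using rep[OF r_pos yM] yM by (auto simp: u_def N_def)
    have r0: "r 0 \<le> r i" "r i \<le> r (Suc i)" by (auto intro: r_le)
    have "d x y \<le> r (Suc i)" using y(1) by simp
    then have "d x u \<le> r (Suc i)"
      using ultrametric[OF x u(1) yM] u(2) r0 by linarith
    moreover have "r i \<le> d x u"
      using ultrametric[OF x yM u(1)] y(2) u(2) r0 commute[of u y] by linarith
    moreover have "r n < r i" using i(1) r_mono by (simp add: strict_mono_less)
    ultimately have "u \<in> N \<inter> mcball x (r (Suc i))" "u \<notin> N \<inter> mcball x (r n)" using u x by auto
    moreover have "N \<inter> mcball x (r n) \<subseteq> N \<inter> mcball x (r (Suc i))"
      using r_le[of n "Suc i"] i(1) by auto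
    ultimately have "N \<inter> mcball x (r n) \<subset> N \<inter> mcball x (r (Suc i))" by blast
    then have "vol n x < vol (Suc i) x" unfolding vol_def by (rule psubset_card_mono[OF finite_N_ball[OF x]])
    then show ?thesis using n x by (meson Suc_leI le_less_trans order_refl)
  qed
  then have "\<forall>m\<ge>Suc i. \<forall>x\<in>M. Suc j \<le> vol m x" using vol_mono by (meson order_trans)
  then show ?case by (rule exI)
qed

text \<open>
  Scales and block lengths are chosen alternately: volumes of a fixed scale are bounded, so a longer
  block dwarfs them; volumes tend to infinity, so a later scale dwarfs that block. Block lengths are
  powers of two, so that blocks become balls of the anti-Cantor set.
\<close>

lemma separated_scales:
  "\<exists>b m. b 0 = (0::nat) \<and> (\<forall>n. b n \<le> b (Suc n)) \<and> strict_mono (m :: nat \<Rightarrow> nat) \<and>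
    (\<forall>n. \<forall>x\<in>M. 2 ^ (n + 6) * 2 ^ b n \<le> vol (m n) x) \<and>
    (\<forall>n. \<forall>x\<in>M. 2 ^ (n + 6) * vol (m n) x \<le> 2 ^ b (Suc n))"
proof -
  define P where "P n s \<longleftrightarrow> (\<forall>x\<in>M. 2 ^ (n + 6) * 2 ^ fst s \<le> vol (snd s) x) \<and> (n = 0 \<longrightarrow> fst s = 0)"
    for n :: nat and s :: "nat \<times> nat"
  define Q where "Q n s s' \<longleftrightarrow> snd s < snd s' \<and> fst s \<le> fst s' \<and> (\<forall>x\<in>M. 2 ^ (n + 6) * vol (snd s) x \<le> 2 ^ fst s')"
    for n :: nat and s s' :: "nat \<times> nat"
  have "\<exists>F. \<forall>n. P n (F n) \<and> Q n (F n) (F (Suc n))"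
  proof (rule dependent_nat_choice)
    obtain m where "\<forall>k\<ge>m. \<forall>x\<in>M. 2 ^ 6 \<le> vol k x" using vol_unbounded[of "2 ^ 6"] by (elim exE)
    then have "P 0 (0, m)" by (simp add: P_def)
    then show "\<exists>s. P 0 s" by blast
  next
    fix s :: "nat \<times> nat" and n
    obtain q where q: "\<forall>x\<in>M. finite (N \<inter> mcball x (r (snd s))) \<and> vol (snd s) x \<le> q"
      using vol_bounded[of "snd s"] by (elim exE)
    \<comment> \<open>large enough because \<open>k < 2 ^ k\<close> for every natural number \<open>k\<close>\<close>
    define b' where "b' = fst s + 2 ^ (n + 6) * q"
    obtain k where k: "\<forall>m\<ge>k. \<forall>x\<in>M. 2 ^ (Suc n + 6) * 2 ^ b' \<le> vol m x"
      using vol_unbounded[of "2 ^ (Suc n + 6) * 2 ^ b'"] by (elim exE)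
    define m' where "m' = max k (Suc (snd s))"
    have "P (Suc n) (b', m')" using k by (simp add: P_def m'_def)
    moreover have "2 ^ (n + 6) * vol (snd s) x \<le> 2 ^ b'" if "x \<in> M" for x
    proof -
      have "2 ^ (n + 6) * vol (snd s) x \<le> 2 ^ (n + 6) * q" using q that by simp
      also have "\<dots> \<le> b'" by (simp add: b'_def)
      also have "\<dots> \<le> 2 ^ b'" by (rule less_imp_le[OF less_exp])
      finally show ?thesis .
    qed
    then have "Q n s (b', m')" by (auto simp: Q_def b'_def m'_def)
    ultimately show "\<exists>s'. P (Suc n) s' \<and> Q n s s'" by blast
  qed
  then obtain F where F: "\<forall>n. P n (F n) \<and> Q n (F n) (F (Suc n))" by (elim exE)
  have "strict_mono (\<lambda>n. snd (F n))" using F by (simp add: strict_mono_Suc_iff Q_def)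
  then show ?thesis using F unfolding P_def Q_def
    by (intro exI[of _ "\<lambda>n. fst (F n)"] exI[of _ "\<lambda>n. snd (F n)"]) auto
qed

lemma coarsely_equivalent_anti_cantor: "coarsely_equivalent M d anti_cantor anti_cantor_dist"
proof -
  obtain b m where bm: "b 0 = (0::nat)" "\<forall>n. b n \<le> b (Suc n)" "strict_mono (m :: nat \<Rightarrow> nat)"
    "\<forall>n. \<forall>x\<in>M. 2 ^ (n + 6) * 2 ^ b n \<le> vol (m n) x"
    "\<forall>n. \<forall>x\<in>M. 2 ^ (n + 6) * vol (m n) x \<le> 2 ^ b (Suc n)"
    using separated_scales by (elim exE conjE)
  define R where "R n = r (m n)" for n
  have R: "r 0 \<le> R n" "n \<le> k \<Longrightarrow> R n \<le> R k" "0 \<le> R n" for n k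
    unfolding R_def using r_le[of 0 "m n"] r_le[of "m n" "m k"] strict_mono_less_eq[OF bm(3)] less_imp_le[OF r_pos]
    by auto
  have R_reaches: "\<exists>n. t \<le> R n" for t
  proof -
    obtain i where i: "t \<le> r i" using r_reaches[of 0 t] by (elim exE conjE)
    have "r i \<le> R i" unfolding R_def by (rule r_le) (rule strict_mono_imp_increasing[OF bm(3)])
    then show ?thesis using i by (intro exI[of _ i]) simp
  qed
  define cl where "cl n x = N \<inter> mcball x (R n)" for n x
  interpret T: block_tower N cl "\<lambda>n. 2 ^ b n"
  proof
    fix n :: nat and x y assume x: "x \<in> N"
    then have xM: "x \<in> M" using N_sub by blast
    show "x \<in> cl n x" using x xM R(3) by (simp add: cl_def)
    show "cl n x \<subseteq> N" by (simp add: cl_def)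
    show "cl n y = cl n x" if y: "y \<in> cl n x"
    proof -
      have "y \<in> M" "d x y \<le> R n" using y by (auto simp: cl_def)
      then show ?thesis unfolding cl_def using mcball_eq[OF xM] by simp
    qed
    show "cl n x \<subseteq> cl (Suc n) x" using R(2)[of n "Suc n"] by (auto simp: cl_def)
    show "\<exists>n. y \<in> cl n x" if y: "y \<in> N"
    proof -
      obtain n where "d x y \<le> R n" using R_reaches[of "d x y"] by (elim exE)
      then show ?thesis using xM y N_sub by (intro exI[of _ n]) (auto simp: cl_def)
    qed
    show "finite (cl n x)" unfolding cl_def R_def by (rule finite_N_ball[OF xM])
    show "2 ^ (n + 6) * 2 ^ b n \<le> card (cl n x)" "2 ^ (n + 6) * card (cl n x) \<le> 2 ^ b (Suc n)"
      using bm(4,5) xM unfolding cl_def R_def vol_def by auto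
  qed (use bm(1,2) in \<open>auto simp: le_imp_power_dvd\<close>)
  obtain x0 where x0: "x0 \<in> N" using nonempty by (auto simp: N_def)
  obtain f :: "'a \<Rightarrow> nat" where f: "f ` N = UNIV"
    "\<forall>n. \<forall>x\<in>N. \<forall>y\<in>cl n x. f x div 2 ^ b (Suc n) = f y div 2 ^ b (Suc n)"
    "\<forall>n. \<forall>x\<in>N. \<forall>y\<in>N. f x div 2 ^ b n = f y div 2 ^ b n \<longrightarrow> cl n x = cl n y"
    using T.interleaved_surjection[OF x0] by (elim exE conjE)
  define F where "F x = digits (f (rep (r 0) x))" for x
  have repN: "rep (r 0) x \<in> N" if "x \<in> M" for x using that by (simp add: N_def)
  show ?thesis
  proof (rule coarsely_equivalent_by_surjection)
    have "F ` M = digits ` f ` N" unfolding F_def N_def by (simp add: image_image)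
    also have "\<dots> = anti_cantor" unfolding f(1) using digits_in_anti_cantor digits_surj by blast
    finally show surj: "F ` M = anti_cantor" .
    show "bornologous M d anti_cantor anti_cantor_dist F"
      unfolding bornologous_def
    proof (intro conjI allI)
      show "F \<in> M \<rightarrow> anti_cantor" using surj by blast
      fix \<epsilon> :: real
      obtain n where n: "\<epsilon> \<le> R n" using R_reaches[of \<epsilon>] by (elim exE)
      have "anti_cantor_dist (F x) (F y) \<le> 2 ^ b (Suc n)" if x: "x \<in> M" and y: "y \<in> M" and "d x y \<le> \<epsilon>" for x y
      proof -
        have "d x y \<le> R n" using that(3) n by simp
        then have "rep (r 0) y \<in> cl n (rep (r 0) x)"
          using dist_rep_le[OF r_pos x y R(1)] repN[OF y] rep(1)[OF r_pos] x y by (simp add: cl_def)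
        then have "f (rep (r 0) x) div 2 ^ b (Suc n) = f (rep (r 0) y) div 2 ^ b (Suc n)"
          using f(2) repN[OF x] by blast
        then show ?thesis unfolding F_def by (rule digits_dist_le)
      qed
      then show "\<exists>\<delta>. \<forall>x\<in>M. \<forall>x'\<in>M. d x x' \<le> \<epsilon> \<longrightarrow> anti_cantor_dist (F x) (F x') \<le> \<delta>"
        by (intro exI[of _ "2 ^ b (Suc n)"]) simp
    qed
    fix \<epsilon> :: real
    obtain k where k: "\<epsilon> < real k" using reals_Archimedean2[of \<epsilon>] by (elim exE)
    define n where "n = Suc k"
    have "k < 2 ^ b n" unfolding n_def by (rule T.B_gt[OF x0])
    then have "real k < real (2 ^ b n)" by (simp only: of_nat_less_iff)
    moreover have "real (2 ^ b n) = 2 ^ b n" by simp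
    ultimately have n: "\<epsilon> < 2 ^ b n" using k by linarith
    have "d x y \<le> R n" if x: "x \<in> M" and y: "y \<in> M" and "anti_cantor_dist (F x) (F y) \<le> \<epsilon>" for x y
    proof -
      have "anti_cantor_dist (F x) (F y) < 2 ^ b n" using that(3) n by simp
      then have "f (rep (r 0) x) div 2 ^ b n = f (rep (r 0) y) div 2 ^ b n"
        unfolding F_def by (rule digits_dist_less)
      then have "cl n (rep (r 0) x) = cl n (rep (r 0) y)"
        by (rule f(3)[rule_format, OF repN[OF x] repN[OF y]])
      then have "rep (r 0) y \<in> cl n (rep (r 0) x)" using T.c_self[OF repN[OF y]] by simp
      then have "d (rep (r 0) x) (rep (r 0) y) \<le> R n" by (simp add: cl_def)
      then show ?thesis by (rule dist_le_rep[OF r_pos x y R(1)])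
    qed
    then show "\<exists>C. \<forall>x\<in>M. \<forall>x'\<in>M. anti_cantor_dist (F x) (F x') \<le> \<epsilon> \<longrightarrow> d x x' \<le> C"
      by (intro exI[of _ "R n"]) simp
  next
    fix y assume "y \<in> anti_cantor"
    then show "anti_cantor_dist y y = 0" by (simp add: anti_cantor.mdist_zero)
  qed
qed

end

theorem theorem2:
  fixes X :: "'a set" and d :: "'a \<Rightarrow> 'a \<Rightarrow> real"
  assumes "Proper_metric_space X d" and "Ultrametric_space X d"
    and "\<exists>r :: nat \<Rightarrow> real.
           (\<forall>n. 0 < r n) \<and> strict_mono r \<and> \<not> bdd_above (range r) \<and>
           (\<Prod>n. ennreal_of_enat (Metric_space.Ent_sup X d (r n) (r (Suc n))) /
                 ennreal_of_enat (Metric_space.ent_min X d (r n) (r (Suc n)))) < \<infinity>"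
  shows "coarsely_equivalent X d anti_cantor anti_cantor_dist"
proof -
  interpret Proper_metric_space X d by (rule assms(1))
  interpret Ultrametric_space X d by (rule assms(2))
  obtain r :: "nat \<Rightarrow> real" where r: "\<forall>n. 0 < r n" "strict_mono r" "\<not> bdd_above (range r)"
    and prod: "(\<Prod>n. ennreal_of_enat (Ent_sup (r n) (r (Suc n))) / ennreal_of_enat (ent_min (r n) (r (Suc n)))) < \<infinity>"
    using assms(3) by (elim exE conjE)
  note entropy = entropy_of_finite_product[OF r(1)[rule_format] prod]
  interpret tame_scales X d r
    by unfold_locales (rule r(1)[rule_format] r(2,3) entropy)+
  show ?thesis by (rule coarsely_equivalent_anti_cantor)
qed

end
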